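(* Let $D$ be an integral domain that is not a field. (1) $D$ is a PID if and only if every maximal ideal $M$ of $D$ is principal and $\bigcap_{n=1}^{\infty}M^n=(0)$. (2) $D$ is a Dedekind domain if and only if every maximal ideal $M$ of $D$ is invertible and $\bigcap_{n=1}^{\infty}M^n=(0)$. (3) $D$ is a UFD if and only if every maximal $t$-ideal $M$ of $D$ is principal and $\bigcap_{n=1}^{\infty}M^n=(0)$. (4) $D$ is a locally factorial Krull domain if and only if every maximal $t$-ideal $M$ of $D$ is invertible and $\bigcap_{n=1}^{\infty}M^n=(0)$. (5) $D$ is a Krull domain if and only if every maximal $t$-ideal $M$ of $D$ is $t$-invertible and $\bigcap_{n=1}^{\infty}(M^n)_v=(0)$. (In each item, the right-hand condition is that every such $M$ satisfies both properties.)
   Context: $D$ has quotient field $K$. For a nonzero fractional ideal $I$ put $I^{-1}=\{x\in K\mid xI\subseteq D\}$, $I_v=(I^{-1})^{-1}$, and $I_t=\bigcup\{J_v\mid J\subseteq I,\ J \text{ a nonzero finitely generated fractional ideal}\}$. $I$ is a $t$-ideal if $I_t=I$; a maximal $t$-ideal is an ideal maximal among the $t$-ideals properly contained in $D$. $I$ is invertible if $II^{-1}=D$ and $t$-invertible if $(II^{-1})_t=D$. A domain is locally factorial if its localization at every maximal ideal is a UFD. *)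

theory Defs
  imports
    "HOL-Algebra.Algebraic_Closure_Type"
    "HOL-Algebra.Ideal_Product"
    "HOL-Algebra.Ring_Divisibility"
begin

text \<open>
  A domain is given as a subset \<open>D\<close> of its quotient field, which is a type \<open>'k\<close> of class
  \<open>field\<close>. Fractional ideals, localizations and \<open>D\<close> itself are then subsets of \<open>'k\<close>, and
  \<open>ring_on S\<close> is the HOL-Algebra ring structure that \<open>'k\<close> induces on a subset \<open>S\<close>.
\<close>

abbreviation ring_on :: "'k::field set \<Rightarrow> 'k ring" where
  "ring_on S \<equiv> ring_of_type_algebra\<lparr>carrier := S\<rparr>"

definition has_quotient_field :: "'k::field set \<Rightarrow> bool" where
  "has_quotient_field D \<longleftrightarrow> (\<forall>x::'k. \<exists>a\<in>D. \<exists>b\<in>D - {0}. x = a / b)"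


section \<open>Fractional ideals and the \<open>v\<close>- and \<open>t\<close>-operations\<close>

definition fractional_ideal :: "'k::field set \<Rightarrow> 'k set \<Rightarrow> bool" where
  "fractional_ideal D I \<longleftrightarrow>
     0 \<in> I \<and> (\<forall>x\<in>I. \<forall>y\<in>I. x + y \<in> I) \<and> (\<forall>d\<in>D. \<forall>x\<in>I. d * x \<in> I) \<and>
     (\<exists>d\<in>D - {0}. \<forall>x\<in>I. d * x \<in> D)"

definition fg_fractional_ideal :: "'k::field set \<Rightarrow> 'k set \<Rightarrow> bool" where
  "fg_fractional_ideal D I \<longleftrightarrow> fractional_ideal D I \<and>
     (\<exists>S. finite S \<and> I = {\<Sum>s\<in>S. c s * s | c. \<forall>s\<in>S. c s \<in> D})"

definition frac_inverse :: "'k::field set \<Rightarrow> 'k set \<Rightarrow> 'k set" where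
  "frac_inverse D I = {x. \<forall>y\<in>I. x * y \<in> D}"

definition v_closure :: "'k::field set \<Rightarrow> 'k set \<Rightarrow> 'k set" where
  "v_closure D I = frac_inverse D (frac_inverse D I)"

definition t_closure :: "'k::field set \<Rightarrow> 'k set \<Rightarrow> 'k set" where
  "t_closure D I = \<Union>{v_closure D J | J. J \<subseteq> I \<and> J \<noteq> {0} \<and> fg_fractional_ideal D J}"

definition t_ideal :: "'k::field set \<Rightarrow> 'k set \<Rightarrow> bool" where
  "t_ideal D I \<longleftrightarrow> fractional_ideal D I \<and> I \<noteq> {0} \<and> t_closure D I = I"

definition maximal_t_ideal :: "'k::field set \<Rightarrow> 'k set \<Rightarrow> bool" where
  "maximal_t_ideal D M \<longleftrightarrow> t_ideal D M \<and> M \<subset> D \<and>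
     (\<forall>I. t_ideal D I \<longrightarrow> I \<subset> D \<longrightarrow> M \<subseteq> I \<longrightarrow> I = M)"

text \<open>
  \<open>ideal_prod R I J\<close> consists of the finite sums of products \<open>i * j\<close> and uses only the operations
  of \<open>R\<close>, so with \<open>R\<close> the quotient field it is also the product of fractional ideals.
\<close>

definition invertible_ideal :: "'k::field set \<Rightarrow> 'k set \<Rightarrow> bool" where
  "invertible_ideal D I \<longleftrightarrow> fractional_ideal D I \<and> I \<noteq> {0} \<and>
     ideal_prod (ring_of_type_algebra :: 'k ring) I (frac_inverse D I) = D"

definition t_invertible_ideal :: "'k::field set \<Rightarrow> 'k set \<Rightarrow> bool" where
  "t_invertible_ideal D I \<longleftrightarrow> fractional_ideal D I \<and> I \<noteq> {0} \<and>
     t_closure D (ideal_prod (ring_of_type_algebra :: 'k ring) I (frac_inverse D I)) = D"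

abbreviation ideal_power :: "'k::field set \<Rightarrow> 'k set \<Rightarrow> nat \<Rightarrow> 'k set" where
  "ideal_power D M n \<equiv> M [^]\<^bsub>ideals_set (ring_on D)\<^esub> n"


section \<open>Classes of domains\<close>

text \<open>
  PIDs and UFDs are the library's \<open>principal_domain\<close> and \<open>factorial_domain\<close>. In the definitions
  below \<open>D\<close> is understood to be a domain with quotient field \<open>'k\<close>.
\<close>

definition integrally_closed_domain :: "'k::field set \<Rightarrow> bool" where
  "integrally_closed_domain D \<longleftrightarrow>
     (\<forall>x::'k. \<forall>n>0. \<forall>c. (\<forall>i<n. c i \<in> D) \<longrightarrow> x ^ n + (\<Sum>i<n. c i * x ^ i) = 0 \<longrightarrow> x \<in> D)"

definition dedekind_domain :: "'k::field set \<Rightarrow> bool" where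
  "dedekind_domain D \<longleftrightarrow> noetherian_domain (ring_on D) \<and> integrally_closed_domain D \<and>
     (\<forall>P. primeideal P (ring_on D) \<longrightarrow> P \<noteq> {0} \<longrightarrow> maximalideal P (ring_on D))"

definition localization :: "'k::field set \<Rightarrow> 'k set \<Rightarrow> 'k set" where
  "localization D P = {a / s | a s. a \<in> D \<and> s \<in> D - P}"

definition locally_factorial :: "'k::field set \<Rightarrow> bool" where
  "locally_factorial D \<longleftrightarrow>
     (\<forall>M. maximalideal M (ring_on D) \<longrightarrow> factorial_domain (ring_on (localization D M)))"

definition discrete_valuation_ring :: "'k::field set \<Rightarrow> bool" where
  "discrete_valuation_ring V \<longleftrightarrow> principal_domain (ring_on V) \<and> \<not> field (ring_on V) \<and>
     (\<exists>!M. maximalideal M (ring_on V))"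

definition height_one_primes :: "'k::field set \<Rightarrow> 'k set set" where
  "height_one_primes D = {P. primeideal P (ring_on D) \<and> P \<noteq> {0} \<and>
     (\<forall>Q. primeideal Q (ring_on D) \<longrightarrow> Q \<noteq> {0} \<longrightarrow> Q \<subseteq> P \<longrightarrow> Q = P)}"

definition krull_domain :: "'k::field set \<Rightarrow> bool" where
  "krull_domain D \<longleftrightarrow> domain (ring_on D) \<and>
     (\<forall>P\<in>height_one_primes D. discrete_valuation_ring (localization D P)) \<and>
     (\<Inter>P\<in>height_one_primes D. localization D P) = D \<and>
     (\<forall>a\<in>D - {0}. finite {P \<in> height_one_primes D. a \<in> P})"

end

theory Submission
  imports Defs "HOL-Library.Set_Algebras"
begin

text \<open>
  The trivial operation \<open>d\<close> and the operation \<open>t\<close> are star operations of finite type, and each of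
  the five classes of domains is characterized by the ideals being good for one of them: all
  \<open>d\<close>-ideals are principal (PID) or invertible (Dedekind), and all \<open>t\<close>-ideals are principal (UFD),
  invertible (locally factorial Krull) or \<open>t\<close>-invertible (Krull). In each case it suffices to look
  at maximal ideals \<open>M\<close> whose powers meet in zero: if \<open>I\<close> is maximal among the bad ideals and
  \<open>I \<subseteq> M\<close>, then \<open>I M\<^sup>-\<^sup>1\<close> contains \<open>I\<close>; if it is larger it is good and so is \<open>I = (I M\<^sup>-\<^sup>1) M\<close>, and
  otherwise \<open>I = I M = I M\<^sup>2 = \<dots>\<close> lies in all powers of \<open>M\<close>. Conversely, if all ideals are
  invertible, then \<open>J = \<Inter> M\<^sup>n\<close> satisfies \<open>J M\<^sup>-\<^sup>1 \<subseteq> J\<close>, which forces \<open>J = 0\<close>.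
\<close>

section \<open>Subsets of the quotient field\<close>

text \<open>The argument yields statements about the closed powers cl(M^n), whereas the items speak
  of M^n or (M^n)_v. The bridge is that a closed invertible ideal equals its v-closure: for
  invertible M the ideals M^n, (M^n)_t and (M^n)_v coincide, and for t-invertible M still (M^n)_t =
  (M^n)_v, which is where the v in item (5) comes from. A maximal bad ideal exists although D is not
  assumed Noetherian: good ideals are invertible, hence closures of finite sets, so if the union of
  a chain of bad ideals were good, it would be a member of the chain. In the converse, J M^-1
  \<subseteq> J gives J M = J, and an invertible J could be cancelled to M = D. Goodness is kept as
  a parameter since it may be stronger than invertibility for the operation at hand. The remaining
  work is to match each classical class with "all ideals are good". For UFDs, Krull domains and
  locally factorial Krull domains one direction reuses the criterion: only maximal t-ideals have to
  be examined. In a Krull domain these are height one primes, at which the localization is a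
  discrete valuation ring.\<close>

locale domain_in_field =
  fixes D :: "'k::field set"
  assumes zero_mem [simp, intro]: "0 \<in> D"
    and one_mem [simp, intro]: "1 \<in> D"
    and add_mem [intro]: "x \<in> D \<Longrightarrow> y \<in> D \<Longrightarrow> x + y \<in> D"
    and mult_mem [intro]: "x \<in> D \<Longrightarrow> y \<in> D \<Longrightarrow> x * y \<in> D"
    and uminus_mem [intro]: "x \<in> D \<Longrightarrow> - x \<in> D"
    and quotient_field: "has_quotient_field D"
    and not_UNIV: "D \<noteq> UNIV"
begin

lemma fractionE:
  obtains a b where "a \<in> D" "b \<in> D" "b \<noteq> 0" "x = a / b"
  using quotient_field unfolding has_quotient_field_def by blast

lemma power_mem [intro]: "x \<in> D \<Longrightarrow> x ^ n \<in> D"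
  by (induction n) auto

end

text \<open>The d-operation is taken on arbitrary subsets of K, like \<open>tspan\<close>, so that
  both become total closure operations and instances of one locale.\<close>

inductive_set dspan :: "'k::field set \<Rightarrow> 'k set \<Rightarrow> 'k set" for D S where
  zero: "0 \<in> dspan D S"
| scale: "d \<in> D \<Longrightarrow> x \<in> S \<Longrightarrow> d * x \<in> dspan D S"
| add: "x \<in> dspan D S \<Longrightarrow> y \<in> dspan D S \<Longrightarrow> x + y \<in> dspan D S"

text \<open>
  This is \<open>t_closure\<close> on nonzero \<open>D\<close>-submodules, but it is a closure operation on all subsets,
  so no fractionality conditions arise for products.
\<close>

definition tspan :: "'k::field set \<Rightarrow> 'k set \<Rightarrow> 'k set" where
  "tspan D S = (\<Union>F\<in>{F. finite F \<and> F \<subseteq> S}. v_closure D F)"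

lemma set_times_memI: "a \<in> A \<Longrightarrow> b \<in> B \<Longrightarrow> x = a * b \<Longrightarrow> x \<in> A * B"
  by (auto simp: set_times_def)

lemma set_times_subset_iff: "A * B \<subseteq> C \<longleftrightarrow> (\<forall>a\<in>A. \<forall>b\<in>B. a * b \<in> C)"
  by (auto simp: set_times_def)

lemma set_times_memE:
  assumes "x \<in> A * B" obtains a b where "a \<in> A" "b \<in> B" "x = a * b"
  using assms by (auto simp: set_times_def)

lemma one_set_times [simp]:
  fixes S :: "'a::comm_monoid_mult set"
  shows "{1} * S = S" "S * {1} = S"
  by (simp_all flip: set_one)

lemma mem_singleton_times: "(x::'k::field) \<in> {a} * S \<longleftrightarrow> (\<exists>s\<in>S. x = a * s)"
  by (auto simp: set_times_def)

lemma frac_inverse_mono: "A \<subseteq> B \<Longrightarrow> frac_inverse D B \<subseteq> frac_inverse D A"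
  by (auto simp: frac_inverse_def)

lemma subset_v_closure: "S \<subseteq> v_closure D S"
  by (auto simp: v_closure_def frac_inverse_def mult.commute)

lemma v_closure_mono: "A \<subseteq> B \<Longrightarrow> v_closure D A \<subseteq> v_closure D B"
  by (simp add: v_closure_def frac_inverse_mono)

lemma frac_inverse_v_closure: "frac_inverse D (v_closure D S) = frac_inverse D S"
  using subset_v_closure[of "frac_inverse D S" D] frac_inverse_mono[OF subset_v_closure[of S D]]
  by (auto simp: v_closure_def)

lemma v_closure_idem: "v_closure D (v_closure D S) = v_closure D S"
  by (metis frac_inverse_v_closure v_closure_def)

lemma v_closure_subset_iff: "A \<subseteq> v_closure D B \<longleftrightarrow> v_closure D A \<subseteq> v_closure D B"
  by (metis subset_v_closure subset_trans v_closure_idem v_closure_mono)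

lemma mult_v_closure: "x \<in> v_closure D S \<Longrightarrow> a * x \<in> v_closure D ({a} * S)"
  by (auto simp: v_closure_def frac_inverse_def set_times_def)
     (metis mult.assoc mult.commute)

lemma times_frac_inverse_subset: "S * frac_inverse D S \<subseteq> D"
  by (auto simp: set_times_def frac_inverse_def mult.commute)

lemma frac_inverse_memD: "x \<in> frac_inverse D S \<Longrightarrow> y \<in> S \<Longrightarrow> x * y \<in> D"
  by (auto simp: frac_inverse_def)

lemma frac_inverse_memD': "x \<in> frac_inverse D S \<Longrightarrow> y \<in> S \<Longrightarrow> y * x \<in> D"
  by (auto simp: frac_inverse_def mult.commute)

section \<open>Star operations of finite type\<close>

text \<open>Star operations of finite type, axiomatized on all subsets of K. The classical law
  (aI)_* = a I_* appears as the inclusion \<open>mult_cl\<close> alone; for a \<noteq> 0 the other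
  inclusion follows by multiplying with the inverse of a. \<open>cl_finite\<close> is the finite
  type condition on which the uses of Zorn's lemma rest.\<close>

locale star_operation = domain_in_field D for D :: "'k::field set" +
  fixes cl :: "'k set \<Rightarrow> 'k set"
  assumes subset_cl: "S \<subseteq> cl S"
    and cl_mono: "A \<subseteq> B \<Longrightarrow> cl A \<subseteq> cl B"
    and cl_idem: "cl (cl S) = cl S"
    and mult_cl: "x \<in> cl S \<Longrightarrow> a * x \<in> cl ({a} * S)"
    and cl_one: "cl {1} = D"
    and zero_cl: "0 \<in> cl S"
    and add_cl: "x \<in> cl S \<Longrightarrow> y \<in> cl S \<Longrightarrow> x + y \<in> cl S"
    and cl_finite: "x \<in> cl S \<Longrightarrow> \<exists>F. finite F \<and> F \<subseteq> S \<and> x \<in> cl F"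
begin

section \<open>Ideals, invertibility and maximal ideals for a star operation\<close>

definition star_ideal :: "'k set \<Rightarrow> bool" where
  "star_ideal I \<longleftrightarrow> I \<subseteq> D \<and> cl I = I \<and> I \<noteq> {0}"

definition star_invertible :: "'k set \<Rightarrow> bool" where
  "star_invertible I \<longleftrightarrow> 1 \<in> cl (I * frac_inverse D I)"

definition star_maximal :: "'k set \<Rightarrow> bool" where
  "star_maximal M \<longleftrightarrow> star_ideal M \<and> M \<noteq> D \<and>
     (\<forall>I. star_ideal I \<longrightarrow> I \<noteq> D \<longrightarrow> M \<subseteq> I \<longrightarrow> I = M)"

lemma cl_subset_iff: "cl A \<subseteq> cl B \<longleftrightarrow> A \<subseteq> cl B"
  by (metis cl_idem cl_mono subset_cl subset_trans)

lemma cl_subsetI: "A \<subseteq> B \<Longrightarrow> cl B = B \<Longrightarrow> cl A \<subseteq> B"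
  using cl_mono by blast

lemma cl_D: "cl D = D"
  by (metis cl_idem cl_one)

lemma singleton_times_cl: "{a} * cl S \<subseteq> cl ({a} * S)"
  using mult_cl by (auto simp: set_times_def)

text \<open>One factor can be closed at a time: for a fixed left element this is
  \<open>mult_cl\<close>, commutativity handles the other factor, and idempotence removes the second
  closure.\<close>

lemma times_cl_subset: "cl A * cl B \<subseteq> cl (A * B)"
proof -
  have *: "A * cl B \<subseteq> cl (A * B)" for A B
  proof (unfold set_times_subset_iff, intro ballI)
    fix a b assume "a \<in> A" "b \<in> cl B"
    moreover have "{a} * B \<subseteq> A * B" using \<open>a \<in> A\<close> by (intro set_times_mono2) auto
    ultimately show "a * b \<in> cl (A * B)" using mult_cl cl_mono by blast
  qed
  have "cl A * cl B \<subseteq> cl (cl A * B)" by (rule *)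
  also have "cl A * B \<subseteq> cl (A * B)" using *[of B A] by (simp add: mult.commute)
  then have "cl (cl A * B) \<subseteq> cl (A * B)" by (simp add: cl_subset_iff)
  finally show ?thesis .
qed

lemma cl_times_cl: "cl (cl A * cl B) = cl (A * B)"
  by (metis cl_subset_iff equalityI cl_mono set_times_mono2 subset_cl times_cl_subset)

lemma cl_times_cl_left: "cl (cl A * B) = cl (A * B)"
  by (metis cl_idem cl_times_cl)

lemma cl_times_cl_right: "cl (A * cl B) = cl (A * B)"
  by (metis cl_idem cl_times_cl)

lemma cl_times_cl_assoc: "cl (cl (A * B) * C) = cl (B * (A * C))"
  by (simp add: cl_times_cl_left mult.assoc mult.left_commute[of B])

lemma scale_cl: "d \<in> D \<Longrightarrow> x \<in> cl S \<Longrightarrow> d * x \<in> cl S"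
  using times_cl_subset[of "{1}" S] by (auto simp: cl_one set_times_subset_iff)

lemma D_times_subset: "cl S = S \<Longrightarrow> D * S \<subseteq> S"
  unfolding set_times_subset_iff using scale_cl by metis

text \<open>The v-operation is the coarsest star operation: an element of S^-1 multiplies S into D,
  and as D is closed, it multiplies cl S into D as well.\<close>

lemma cl_subset_v_closure: "cl S \<subseteq> v_closure D S"
proof
  fix x assume x: "x \<in> cl S"
  have "x * y \<in> D" if y: "y \<in> frac_inverse D S" for y
  proof -
    have "y * x \<in> cl ({y} * S)" using x by (rule mult_cl)
    also have "cl ({y} * S) \<subseteq> D"
      using y by (intro cl_subsetI[OF _ cl_D]) (auto simp: set_times_def frac_inverse_def)
    finally show ?thesis by (simp add: mult.commute)
  qed
  then show "x \<in> v_closure D S" by (simp add: v_closure_def frac_inverse_def)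
qed

lemma frac_inverse_cl: "frac_inverse D (cl S) = frac_inverse D S"
  by (metis cl_subset_v_closure equalityI frac_inverse_mono frac_inverse_v_closure subset_cl)

lemma cl_frac_inverse: "cl (frac_inverse D S) = frac_inverse D S"
  by (metis cl_subset_v_closure frac_inverse_v_closure subset_antisym subset_cl v_closure_def)

lemma star_idealD:
  assumes "star_ideal I"
  shows "I \<subseteq> D" "cl I = I" "0 \<in> I" "I \<noteq> {0}" "\<exists>a\<in>I. a \<noteq> 0"
proof -
  show "I \<subseteq> D" "cl I = I" "I \<noteq> {0}" using assms by (auto simp: star_ideal_def)
  then show "0 \<in> I" by (metis zero_cl)
  with \<open>I \<noteq> {0}\<close> show "\<exists>a\<in>I. a \<noteq> 0" by blast
qed

lemma star_idealI: "S \<subseteq> D \<Longrightarrow> a \<in> S \<Longrightarrow> a \<noteq> 0 \<Longrightarrow> star_ideal (cl S)"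
  unfolding star_ideal_def using subset_cl[of S] cl_D cl_mono[of S D] by (auto simp: cl_idem)

lemma star_ideal_scale: "star_ideal I \<Longrightarrow> d \<in> D \<Longrightarrow> x \<in> I \<Longrightarrow> d * x \<in> I"
  using scale_cl star_idealD(2) by metis

lemma star_ideal_eq_D_iff: "star_ideal I \<Longrightarrow> I = D \<longleftrightarrow> 1 \<in> I"
  using star_ideal_scale[of I _ 1] star_idealD(1)[of I] by auto

lemma cl_times_subset_left: "star_ideal I \<Longrightarrow> J \<subseteq> D \<Longrightarrow> cl (I * J) \<subseteq> I"
  using star_ideal_scale[of I] star_idealD(2)[of I]
  by (intro cl_subsetI) (auto simp: set_times_subset_iff, metis mult.commute subsetD)

lemma star_maximalD:
  assumes "star_maximal M"
  shows "star_ideal M" "M \<noteq> D" "1 \<notin> M" "M \<subseteq> D"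
    "\<And>I. star_ideal I \<Longrightarrow> I \<noteq> D \<Longrightarrow> M \<subseteq> I \<Longrightarrow> I = M"
  using assms star_ideal_eq_D_iff star_idealD(1) unfolding star_maximal_def by auto

text \<open>Finite type is essential here: an element of the closure of the union comes from a
  finite subset, which already lies in one member of the chain.\<close>

lemma star_ideal_Union_chain:
  assumes "subset.chain {I. star_ideal I} C" "C \<noteq> {}"
  shows "star_ideal (\<Union>C)"
proof -
  have C: "star_ideal I" if "I \<in> C" for I
    using that assms(1) by (auto simp: subset.chain_def)
  have "x \<in> \<Union>C" if "x \<in> cl (\<Union>C)" for x
  proof -
    obtain F where F: "finite F" "F \<subseteq> \<Union>C" "x \<in> cl F" using \<open>x \<in> cl (\<Union>C)\<close> cl_finite by blast
    then obtain I where "I \<in> C" "F \<subseteq> I" using assms finite_subset_Union_chain by metis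
    then show ?thesis using F(3) C cl_mono star_idealD(2) by blast
  qed
  then have "cl (\<Union>C) = \<Union>C" using subset_cl by blast
  moreover have "\<Union>C \<subseteq> D" using C star_idealD(1) by blast
  moreover obtain I where "I \<in> C" using assms(2) by blast
  ultimately show ?thesis using C star_idealD(5)[OF C[OF \<open>I \<in> C\<close>]]
    by (auto simp: star_ideal_def)
qed

lemma subset_star_maximal:
  assumes "star_ideal I" "I \<noteq> D"
  obtains M where "star_maximal M" "I \<subseteq> M"
proof -
  let ?A = "{J. star_ideal J \<and> J \<noteq> D \<and> I \<subseteq> J}"
  have "\<exists>M\<in>?A. \<forall>J\<in>?A. M \<subseteq> J \<longrightarrow> J = M"
  proof (rule subset_Zorn_nonempty)
    show "?A \<noteq> {}" using assms by blast
    fix C assume C: "C \<noteq> {}" "subset.chain ?A C"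
    then have sub: "C \<subseteq> ?A" by (auto simp: subset.chain_def)
    have "star_ideal (\<Union>C)"
      using C by (intro star_ideal_Union_chain) (auto simp: subset.chain_def)
    moreover have "1 \<notin> \<Union>C" using sub star_ideal_eq_D_iff by blast
    moreover have "I \<subseteq> \<Union>C" using sub C(1) by blast
    ultimately show "\<Union>C \<in> ?A" by auto
  qed
  then show ?thesis using that by (fastforce simp: star_maximal_def)
qed

text \<open>If a is not in M, the closure of M with a added is D and contains 1. Multiplying by b
  puts b into the closure of b M and a b, which stays inside M.\<close>

lemma star_maximal_prime:
  assumes M: "star_maximal M" and ab: "a \<in> D" "b \<in> D" "a * b \<in> M" and a: "a \<notin> M"
  shows "b \<in> M"
proof -
  note M' = star_maximalD[OF M]
  obtain m where "m \<in> M" "m \<noteq> 0" using M'(1) star_idealD(5) by blast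
  then have star: "star_ideal (cl (insert a M))"
    using M'(4) ab by (intro star_idealI[of _ m]) auto
  have "cl (insert a M) = D"
    using M'(5)[OF star] a subset_cl[of "insert a M"] by blast
  then have "b * 1 \<in> cl ({b} * insert a M)" by (intro mult_cl) auto
  also have "{b} * insert a M \<subseteq> M"
    using ab star_ideal_scale[OF M'(1) ab(2)] by (auto simp: set_times_def mult.commute)
  then have "cl ({b} * insert a M) \<subseteq> M" using M'(1) star_idealD(2) cl_subsetI by metis
  finally show ?thesis by simp
qed

text \<open>By finite type, 1 lies in the closure of finitely many products a y with a \<in> I and y
  \<in> I^-1. Multiplying by x \<in> I writes x through the elements (x y) a with x y \<in> D, so
  the finitely many a generate I.\<close>

lemma star_invertible_finite:
  assumes "cl I = I" "star_invertible I"
  obtains F where "finite F" "F \<subseteq> I" "cl F = I"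
proof -
  obtain G where G: "finite G" "G \<subseteq> I * frac_inverse D I" "1 \<in> cl G"
    using assms(2) cl_finite unfolding star_invertible_def by metis
  have "\<forall>g\<in>G. \<exists>a\<in>I. g \<in> {a} * frac_inverse D I"
    using G(2) by (fastforce simp: set_times_def)
  then obtain f where f: "\<forall>g\<in>G. f g \<in> I \<and> g \<in> {f g} * frac_inverse D I" by metis
  have "x \<in> cl (f ` G)" if x: "x \<in> I" for x
  proof -
    have "x * 1 \<in> cl ({x} * G)" using G(3) by (rule mult_cl)
    also have "{x} * G \<subseteq> cl (f ` G)"
    proof (unfold set_times_subset_iff, intro ballI)
      fix x' g assume g: "x' \<in> {x}" "g \<in> G"
      then obtain y where y: "y \<in> frac_inverse D I" "g = f g * y" using f by (auto simp: set_times_def)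
      have "(y * x) * f g \<in> cl (f ` G)"
        using y x g subset_cl frac_inverse_memD by (intro scale_cl) blast+
      then show "x' * g \<in> cl (f ` G)" using g y(2) by (metis singletonD mult.commute mult.left_commute)
    qed
    then have "cl ({x} * G) \<subseteq> cl (f ` G)" by (simp add: cl_subset_iff)
    finally show ?thesis by simp
  qed
  moreover have "f ` G \<subseteq> I" using f by blast
  then have "cl (f ` G) \<subseteq> I" using assms(1) cl_subsetI by metis
  ultimately have "cl (f ` G) = I" by blast
  with \<open>f ` G \<subseteq> I\<close> show ?thesis using G(1) that[of "f ` G"] by simp
qed

text \<open>Noetherian induction in which only the ideals satisfying P have to be finitely
  generated. If the union of a chain of counterexamples satisfied P, finitely many generators would
  lie in one member, which would then equal the union; so Zorn's lemma provides a maximal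
  counterexample.\<close>

lemma star_induct:
  assumes fin: "\<And>I. star_ideal I \<Longrightarrow> P I \<Longrightarrow> \<exists>F. finite F \<and> F \<subseteq> I \<and> cl F = I"
    and step: "\<And>I. star_ideal I \<Longrightarrow> (\<And>J. star_ideal J \<Longrightarrow> I \<subset> J \<Longrightarrow> P J) \<Longrightarrow> P I"
    and "star_ideal I"
  shows "P I"
proof (rule ccontr)
  let ?A = "{J. star_ideal J \<and> \<not> P J}"
  assume "\<not> P I"
  have "\<exists>M\<in>?A. \<forall>J\<in>?A. M \<subseteq> J \<longrightarrow> J = M"
  proof (rule subset_Zorn_nonempty)
    show "?A \<noteq> {}" using \<open>star_ideal I\<close> \<open>\<not> P I\<close> by blast
    fix C assume C: "C \<noteq> {}" "subset.chain ?A C"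
    then have sub: "C \<subseteq> ?A" by (auto simp: subset.chain_def)
    have star: "star_ideal (\<Union>C)"
      using C by (intro star_ideal_Union_chain) (auto simp: subset.chain_def)
    have "\<not> P (\<Union>C)"
    proof
      assume "P (\<Union>C)"
      then obtain F where F: "finite F" "F \<subseteq> \<Union>C" "cl F = \<Union>C" using fin[OF star] by metis
      then obtain J where "J \<in> C" "F \<subseteq> J" using C finite_subset_Union_chain by metis
      then have "cl F \<subseteq> J" using sub by (intro cl_subsetI) (auto simp: star_idealD)
      then have "\<Union>C = J" using F(3) \<open>J \<in> C\<close> by blast
      then show False using \<open>J \<in> C\<close> \<open>P (\<Union>C)\<close> sub by auto
    qed
    with star show "\<Union>C \<in> ?A" by blast
  qed
  then obtain M where M: "star_ideal M" "\<not> P M" "\<And>J. star_ideal J \<Longrightarrow> \<not> P J \<Longrightarrow> M \<subseteq> J \<Longrightarrow> J = M"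
    by blast
  then show False using step[of M] by blast
qed

section \<open>Dividing by an invertible maximal ideal\<close>

lemma subset_cl_times_frac_inverse:
  assumes "star_ideal I" "star_ideal M"
  shows "I \<subseteq> cl (I * frac_inverse D M)"
proof -
  have "1 \<in> frac_inverse D M" using assms star_idealD(1) by (auto simp: frac_inverse_def)
  then have "I \<subseteq> I * frac_inverse D M" by (auto intro: set_times_memI)
  then show ?thesis using subset_cl by blast
qed

lemma star_ideal_times_frac_inverse:
  assumes "star_ideal I" "star_ideal M" "I \<subseteq> M"
  shows "star_ideal (cl (I * frac_inverse D M))"
proof -
  have "I * frac_inverse D M \<subseteq> D"
    using assms(3) times_frac_inverse_subset[of M D] set_times_mono2 by blast
  moreover have "1 \<in> frac_inverse D M" using assms star_idealD(1) by (auto simp: frac_inverse_def)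
  then have "I \<subseteq> I * frac_inverse D M" by (auto intro: set_times_memI)
  ultimately show ?thesis using star_idealI star_idealD(5)[OF assms(1)] by blast
qed

lemma cl_times_invertible_cancel:
  assumes "star_invertible M" "cl I = I"
  shows "cl (cl (I * frac_inverse D M) * M) = I"
proof -
  have "cl (cl (I * frac_inverse D M) * M) = cl (I * cl (M * frac_inverse D M))"
    by (simp add: cl_times_cl_left cl_times_cl_right mult.commute mult.left_commute)
  also have "cl (M * frac_inverse D M) = D"
    using assms(1) cl_one unfolding star_invertible_def
    by (metis bot_least cl_D cl_idem cl_mono insert_subset subset_antisym times_frac_inverse_subset)
  also have "cl (I * D) = I"
    using cl_times_cl_right[of I "{1}"] assms(2) by (simp add: cl_one)
  finally show ?thesis .
qed

text \<open>P is separate from invertibility because the two may belong to different operations: for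
  the t-operation it becomes d-invertibility as well as t-invertibility.\<close>

theorem star_ideals_good:
  assumes D: "P D"
    and times: "\<And>I J. star_ideal I \<Longrightarrow> star_ideal J \<Longrightarrow> P I \<Longrightarrow> P J \<Longrightarrow> P (cl (I * J))"
    and inv: "\<And>I. star_ideal I \<Longrightarrow> P I \<Longrightarrow> star_invertible I"
    and maximal: "\<And>M. star_maximal M \<Longrightarrow> P M"
    and powers: "\<And>M. star_maximal M \<Longrightarrow> (\<Inter>n\<in>{1..}. cl (M ^ n)) = {0}"
    and I: "star_ideal I"
  shows "P I"
  using I
proof (induction rule: star_induct[rotated -1, consumes 1])
  case (1 I)
  then show ?case using inv star_invertible_finite star_idealD(2) by metis
next
  case (2 I)
  show ?case
  proof (cases "I = D")
    case False
    then obtain M where M: "star_maximal M" "I \<subseteq> M" using subset_star_maximal 2 by blast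
    note M' = star_maximalD[OF M(1)]
    let ?Q = "cl (I * frac_inverse D M)"
    have Q: "star_ideal ?Q" using star_ideal_times_frac_inverse 2 M M' by blast
    have IQM: "I = cl (?Q * M)"
      using cl_times_invertible_cancel inv maximal M M' 2 star_idealD(2) by metis
    have "?Q \<noteq> I"
    proof
      assume "?Q = I"
      then have IM: "I = cl (I * M)" using IQM by simp
      have "I \<subseteq> cl (M ^ n)" for n
      proof (induction n)
        case 0
        then show ?case using 2 star_idealD(1) cl_one by simp
      next
        case (Suc n)
        have "I = cl (I * M)" by (rule IM)
        also have "\<dots> \<subseteq> cl (cl (M ^ n) * M)" by (intro cl_mono set_times_mono2 Suc order_refl)
        also have "\<dots> = cl (M ^ Suc n)" by (metis cl_times_cl_left mult.commute power_Suc)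
        finally show ?case .
      qed
      then have "I \<subseteq> {0}" using powers[OF M(1)] by blast
      then show False using star_idealD(5)[OF 2(1)] by blast
    qed
    then have "P ?Q" using 2 Q subset_cl_times_frac_inverse M' by blast
    then show ?thesis using IQM times Q M' maximal M by metis
  qed (use D in simp)
qed

text \<open>Cancellation in place of Nakayama's lemma: multiplying J M = J by J^-1 turns 1 \<in>
  cl(J J^-1) into 1 \<in> M.\<close>

lemma star_invertible_absorb:
  assumes J: "star_ideal J" "star_invertible J" and M: "star_ideal M" and JM: "cl (J * M) = J"
  shows "M = D"
proof -
  have "1 \<in> cl (J * frac_inverse D J)" using J(2) by (simp add: star_invertible_def)
  also have "\<dots> = cl (cl (J * M) * frac_inverse D J)" by (simp only: JM)
  also have "\<dots> = cl (M * (J * frac_inverse D J))" by (rule cl_times_cl_assoc)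
  also have "\<dots> \<subseteq> M" by (rule cl_times_subset_left[OF M times_frac_inverse_subset])
  finally show ?thesis using star_ideal_eq_D_iff M by blast
qed

lemma Inter_powers_eq_0:
  assumes inv: "\<And>I. star_ideal I \<Longrightarrow> star_invertible I" and M: "star_ideal M" "M \<noteq> D"
  shows "(\<Inter>n\<in>{1..}. cl (M ^ n)) = {0}"
proof -
  let ?J = "\<Inter>n\<in>{1..}. cl (M ^ n)"
  have sub: "?J \<subseteq> cl (M ^ n)" if "n \<ge> 1" for n using that by auto
  have JD: "?J \<subseteq> M" using sub[of 1] star_idealD(2)[OF M(1)] by simp
  have clJ: "cl ?J = ?J"
  proof -
    have "cl ?J \<subseteq> cl (M ^ n)" if "n \<ge> 1" for n
      using sub[OF that] cl_idem cl_mono by metis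
    then show ?thesis using subset_cl by blast
  qed
  have "?J = {0}"
  proof (rule ccontr)
    assume "?J \<noteq> {0}"
    then have J: "star_ideal ?J" using clJ JD M star_idealD(1) by (auto simp: star_ideal_def)
    have "x * y \<in> ?J" if x: "x \<in> ?J" and y: "y \<in> frac_inverse D M" for x y
    proof
      fix n :: nat assume "n \<in> {1..}"
      \<comment> \<open>One power more than needed is taken, because the factor y \<in> M^-1 uses up
        one factor M.\<close>
      have "x \<in> cl (M ^ Suc n)" using x by (rule subsetD[OF sub, rotated]) simp
      then have "y * x \<in> cl ({y} * M ^ Suc n)" by (rule mult_cl)
      also have "{y} * M ^ Suc n = ({y} * M) * M ^ n" by (simp add: mult.assoc)
      also have "\<dots> \<subseteq> D * M ^ n"
        using y by (intro set_times_mono2) (auto simp: set_times_def frac_inverse_def)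
      then have "cl (({y} * M) * M ^ n) \<subseteq> cl (D * M ^ n)" by (rule cl_mono)
      also have "\<dots> = cl (M ^ n)"
        using cl_times_cl_left[of "{1}" "M ^ n"] by (simp add: cl_one)
      finally show "x * y \<in> cl (M ^ n)" by (simp add: mult.commute)
    qed
    then have "cl (?J * frac_inverse D M) \<subseteq> ?J"
      using clJ by (intro cl_subsetI) (auto simp: set_times_subset_iff)
    then have "cl (?J * frac_inverse D M) = ?J" using subset_cl_times_frac_inverse[OF J M(1)] by blast
    then have JM: "cl (?J * M) = ?J" using cl_times_invertible_cancel[OF inv[OF M(1)] clJ] by simp
    show False using star_invertible_absorb[OF J inv[OF J] M(1) JM] M(2) by blast
  qed
  then show ?thesis .
qed

end

section \<open>The \<open>d\<close>- and \<open>t\<close>-operations\<close>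

lemma v_closure_add: 
  assumes "domain_in_field D" "x \<in> v_closure D S" "y \<in> v_closure D S"
  shows "x + y \<in> v_closure D S"
  using assms domain_in_field.add_mem[OF assms(1)]
  by (auto simp: v_closure_def frac_inverse_def distrib_right)

lemma mem_tspan_iff: "x \<in> tspan D S \<longleftrightarrow> (\<exists>F. finite F \<and> F \<subseteq> S \<and> x \<in> v_closure D F)"
  by (auto simp: tspan_def)

context domain_in_field
begin

lemma dspan_least:
  assumes "S \<subseteq> T" "0 \<in> T" "\<And>x y. x \<in> T \<Longrightarrow> y \<in> T \<Longrightarrow> x + y \<in> T"
    "\<And>d x. d \<in> D \<Longrightarrow> x \<in> T \<Longrightarrow> d * x \<in> T"
  shows "dspan D S \<subseteq> T"
proof
  fix x assume "x \<in> dspan D S"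
  then show "x \<in> T" by induction (use assms in auto)
qed

lemma dspan_scale: "d \<in> D \<Longrightarrow> x \<in> dspan D S \<Longrightarrow> d * x \<in> dspan D S"
proof (rotate_tac, induction rule: dspan.induct)
  case (scale e x)
  then show ?case using dspan.scale[of "d * e" D x S] by (auto simp: mult.assoc)
qed (auto intro: dspan.intros simp: distrib_left)

lemma subset_dspan: "S \<subseteq> dspan D S"
  using dspan.scale[OF one_mem] by (metis mult_1 subsetI)

lemma dspan_mono: "A \<subseteq> B \<Longrightarrow> dspan D A \<subseteq> dspan D B"
  using subset_dspan by (intro dspan_least dspan_scale) (auto intro: dspan.intros)

sublocale d: star_operation D "dspan D"
proof
  show "S \<subseteq> dspan D S" for S by (rule subset_dspan)
  show "dspan D A \<subseteq> dspan D B" if "A \<subseteq> B" for A B using that by (rule dspan_mono)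
  have "dspan D (dspan D S) \<subseteq> dspan D S" for S
    by (rule dspan_least) (auto intro: dspan.zero dspan.add dspan_scale)
  then show "dspan D (dspan D S) = dspan D S" for S using subset_dspan by blast
  show "a * x \<in> dspan D ({a} * S)" if "x \<in> dspan D S" for a x S
    using that
  proof induction
    case (scale d x)
    then have "d * (a * x) \<in> dspan D ({a} * S)" by (intro dspan.scale) (auto simp: set_times_def)
    then show ?case by (simp add: mult.left_commute)
  qed (auto intro: dspan.intros simp: distrib_left)
  have "dspan D {1} \<subseteq> D" by (rule dspan_least) auto
  moreover have "d \<in> dspan D {1}" if "d \<in> D" for d using dspan.scale[OF that, of 1 "{1}"] by simp
  ultimately show "dspan D {1} = D" by blast
  show "\<exists>F. finite F \<and> F \<subseteq> S \<and> x \<in> dspan D F" if "x \<in> dspan D S" for x S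
    using that
  proof induction
    case zero
    then show ?case by (intro exI[of _ "{}"]) (auto intro: dspan.intros)
  next
    case (scale d x)
    then show ?case by (intro exI[of _ "{x}"]) (auto intro: dspan.intros)
  next
    case (add x y)
    then obtain F G where "finite F" "F \<subseteq> S" "x \<in> dspan D F" "finite G" "G \<subseteq> S" "y \<in> dspan D G"
      by blast
    moreover have "dspan D F \<subseteq> dspan D (F \<union> G)" "dspan D G \<subseteq> dspan D (F \<union> G)"
      by (auto intro!: dspan_mono)
    ultimately show ?case by (intro exI[of _ "F \<union> G"]) (auto intro: dspan.intros)
  qed
qed (auto intro: dspan.intros)

lemma v_closure_one: "v_closure D {1} = D"
  by (auto simp: v_closure_def frac_inverse_def) (use one_mem in force)

sublocale t: star_operation D "tspan D"
proof
  show sub: "S \<subseteq> tspan D S" for S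
  proof
    fix x assume "x \<in> S"
    then show "x \<in> tspan D S"
      unfolding mem_tspan_iff using subset_v_closure[of "{x}" D] by (intro exI[of _ "{x}"]) auto
  qed
  show mono: "tspan D A \<subseteq> tspan D B" if "A \<subseteq> B" for A B using that by (auto simp: tspan_def)
  \<comment> \<open>For idempotence, the finite witnesses of the finitely many elements of F are
    merged into one finite set, and idempotence of the v-operation does the rest.\<close>
  have "x \<in> tspan D S" if x: "x \<in> tspan D (tspan D S)" for x S
  proof -
    obtain F where F: "finite F" "F \<subseteq> tspan D S" "x \<in> v_closure D F"
      using x unfolding mem_tspan_iff[of x D "tspan D S"] by blast
    have "\<forall>y\<in>F. \<exists>G. finite G \<and> G \<subseteq> S \<and> y \<in> v_closure D G"
      using F(2) unfolding mem_tspan_iff[symmetric] by blast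
    then obtain G where G: "\<forall>y\<in>F. finite (G y) \<and> G y \<subseteq> S \<and> y \<in> v_closure D (G y)" by metis
    have "F \<subseteq> v_closure D (\<Union>(G ` F))"
    proof
      fix y assume "y \<in> F"
      then show "y \<in> v_closure D (\<Union>(G ` F))"
        using G v_closure_mono[of "G y" "\<Union>(G ` F)" D] by blast
    qed
    then have "x \<in> v_closure D (\<Union>(G ` F))" using F(3) v_closure_subset_iff by blast
    then show ?thesis using F(1) G unfolding mem_tspan_iff by (intro exI[of _ "\<Union>(G ` F)"]) auto
  qed
  then show "tspan D (tspan D S) = tspan D S" for S using sub by blast
  show "a * x \<in> tspan D ({a} * S)" if x: "x \<in> tspan D S" for a x S
  proof -
    obtain F where F: "finite F" "F \<subseteq> S" "x \<in> v_closure D F" using x unfolding mem_tspan_iff by blast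
    have "{a} * F = (*) a ` F" by (auto simp: set_times_def)
    then have "finite ({a} * F)" using F(1) by simp
    moreover have "{a} * F \<subseteq> {a} * S" using F(2) by (rule set_times_mono2[OF order_refl])
    ultimately show ?thesis using mult_v_closure[OF F(3)] unfolding mem_tspan_iff by blast
  qed
  have "tspan D {1} \<subseteq> D"
    using v_closure_mono[of _ "{1}" D] v_closure_one by (auto simp: tspan_def)
  moreover have "D \<subseteq> tspan D {1}" using v_closure_one by (auto simp: tspan_def)
  ultimately show "tspan D {1} = D" by blast
  show "0 \<in> tspan D S" for S by (auto simp: tspan_def v_closure_def frac_inverse_def)
  show "x + y \<in> tspan D S" if xy: "x \<in> tspan D S" "y \<in> tspan D S" for x y S
  proof -
    obtain F G where F: "finite F" "F \<subseteq> S" "x \<in> v_closure D F" and G: "finite G" "G \<subseteq> S" "y \<in> v_closure D G"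
      using xy unfolding mem_tspan_iff by blast
    have "x + y \<in> v_closure D (F \<union> G)"
      using F G v_closure_mono[of _ "F \<union> G" D]
      by (intro v_closure_add[OF domain_in_field_axioms]) blast+
    then show ?thesis using F G unfolding mem_tspan_iff by (intro exI[of _ "F \<union> G"]) auto
  qed
  show "\<exists>F. finite F \<and> F \<subseteq> S \<and> x \<in> tspan D F" if "x \<in> tspan D S" for x S
    using that unfolding mem_tspan_iff by blast
qed

lemma v_closure_subset_tspan: "finite F \<Longrightarrow> v_closure D F \<subseteq> tspan D F"
  by (auto simp: tspan_def)

lemma dspan_subset_tspan: "dspan D S \<subseteq> tspan D S"
  using t.subset_cl t.zero_cl t.add_cl t.scale_cl by (intro dspan_least) auto

lemma tspan_dspan: "tspan D (dspan D S) = tspan D S"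
  by (metis dspan_subset_tspan subset_antisym subset_dspan t.cl_mono t.cl_subset_iff)

lemma dspan_tspan: "dspan D (tspan D S) = tspan D S"
  by (metis dspan_subset_tspan subset_antisym subset_dspan t.cl_idem)

lemma t_star_ideal_imp_d: "t.star_ideal I \<Longrightarrow> d.star_ideal I"
  unfolding t.star_ideal_def d.star_ideal_def by (metis dspan_tspan)

lemma d_invertible_imp_t: "d.star_invertible I \<Longrightarrow> t.star_invertible I"
  unfolding t.star_invertible_def d.star_invertible_def using dspan_subset_tspan by blast

text \<open>If \<open>x \<in> I\<^sub>v\<close> then \<open>x = x \<cdot> 1\<close> lies in \<open>I (x I\<^sup>-\<^sup>1) \<subseteq> I D = I\<close>.\<close>

lemma (in star_operation) star_invertible_v_closure:
  assumes "star_invertible I" "cl I = I"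
  shows "v_closure D I = I"
proof -
  have "x \<in> I" if x: "x \<in> v_closure D I" for x
  proof -
    have "x * 1 \<in> cl ({x} * (I * frac_inverse D I))"
      using assms(1) unfolding star_invertible_def by (rule mult_cl)
    also have "{x} * (I * frac_inverse D I) = I * ({x} * frac_inverse D I)"
      by (rule mult.left_commute)
    finally have x1: "x * 1 \<in> cl (I * ({x} * frac_inverse D I))" .
    have "{x} * frac_inverse D I \<subseteq> D"
      using x by (auto simp: set_times_def v_closure_def frac_inverse_def)
    then have "I * ({x} * frac_inverse D I) \<subseteq> I * D" by (rule set_times_mono2[OF order_refl])
    also have "I * D \<subseteq> I" using D_times_subset[OF assms(2)] by (simp add: mult.commute)
    finally have "cl (I * ({x} * frac_inverse D I)) \<subseteq> cl I" by (rule cl_mono)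
    with x1 show ?thesis using assms(2) by auto
  qed
  then show ?thesis using subset_v_closure by blast
qed

end

section \<open>The notions of HOL-Algebra inside the quotient field\<close>

lemma ring_on_simps [simp]:
  "carrier (ring_on S) = S" "x \<otimes>\<^bsub>ring_on S\<^esub> y = x * y" "x \<oplus>\<^bsub>ring_on S\<^esub> y = x + y"
  "\<one>\<^bsub>ring_on S\<^esub> = 1" "\<zero>\<^bsub>ring_on S\<^esub> = 0"
  by (simp_all add: ring_of_type_algebra_def)

lemma ring_of_type_algebra_simps [simp]:
  "x \<otimes>\<^bsub>ring_of_type_algebra\<^esub> y = x * y" "x \<oplus>\<^bsub>ring_of_type_algebra\<^esub> y = x + y"
  by (simp_all add: ring_of_type_algebra_def)

lemma field_ring_on_UNIV: "field (ring_on (UNIV :: 'k::field set))"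
proof -
  have "ring_on UNIV = (ring_of_type_algebra :: 'k ring)" by (simp add: ring_of_type_algebra_def)
  then show ?thesis using field_from_type_algebra by simp
qed

lemma domain_in_fieldI:
  fixes D :: "'k::field set"
  assumes "domain (ring_on D)" "has_quotient_field D" "\<not> field (ring_on D)"
  shows "domain_in_field D"
proof -
  interpret domain "ring_on D" by fact
  show ?thesis
  proof
    show "0 \<in> D" "1 \<in> D" using zero_closed one_closed by simp_all
    show "x + y \<in> D" "x * y \<in> D" if "x \<in> D" "y \<in> D" for x y
      using that a_closed[of x y] m_closed[of x y] by simp_all
    show "- x \<in> D" if x: "x \<in> D" for x
    proof -
      obtain y where "y \<in> D" "x + y = 0" using x r_neg[of x] a_inv_closed[of x] by auto
      then show ?thesis by (metis add_eq_0_iff minus_minus)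
    qed
    show "D \<noteq> UNIV" using assms(3) field_ring_on_UNIV by blast
  qed fact
qed

context domain_in_field
begin

lemma domain_ring_on: "domain (ring_on D)"
proof -
  have "\<exists>y\<in>D. y + x = 0" if "x \<in> D" for x using uminus_mem[OF that] by (intro bexI[of _ "- x"]) auto
  then have "cring (ring_on D)"
    by (intro cringI abelian_groupI comm_monoidI) (auto simp: algebra_simps)
  then show ?thesis by (intro domain.intro domain_axioms.intro) auto
qed

sublocale R: domain "ring_on D"
  by (rule domain_ring_on)

lemma a_inv_ring_on: "x \<in> D \<Longrightarrow> \<ominus>\<^bsub>ring_on D\<^esub> x = - x"
  by (rule R.minus_equality) auto

lemma Units_ring_on: "Units (ring_on D) = {x\<in>D. x \<noteq> 0 \<and> inverse x \<in> D}"
proof -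
  have "x \<noteq> 0 \<and> inverse x \<in> D" if "x \<in> D" "y \<in> D" "y * x = 1" for x y
    using that inverse_unique[of y x] by (auto simp: inverse_unique mult.commute)
  then show ?thesis
    by (auto simp: Units_def) (metis left_inverse right_inverse)
qed

text \<open>This justifies the locale assumption \<open>D \<noteq> UNIV\<close>: a field contains
  the fractions of its elements, and the fractions over D fill K.\<close>

lemma not_field: "\<not> field (ring_on D)"
proof
  assume "field (ring_on D)"
  then interpret F: field "ring_on D" .
  have "x \<in> D" for x
  proof -
    obtain a b where ab: "a \<in> D" "b \<in> D" "b \<noteq> 0" "x = a / b" by (rule fractionE)
    then have "b \<in> Units (ring_on D)" using F.field_Units by auto
    then have "a * inverse b \<in> D" using ab by (intro mult_mem) (auto simp: Units_ring_on)
    then show ?thesis using ab by (simp add: divide_inverse)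
  qed
  then show False using not_UNIV by blast
qed

lemma ideal_iff: "ideal I (ring_on D) \<longleftrightarrow> I \<subseteq> D \<and> dspan D I = I"
proof
  assume "ideal I (ring_on D)"
  then interpret ideal I "ring_on D" .
  have "I \<subseteq> D" using a_subset by simp
  moreover have "dspan D I \<subseteq> I"
    using I_l_closed zero_closed a_closed by (intro dspan_least) auto
  ultimately show "I \<subseteq> D \<and> dspan D I = I" using subset_dspan by blast
next
  assume I: "I \<subseteq> D \<and> dspan D I = I"
  have closed: "d * x \<in> I" if "d \<in> D" "x \<in> I" for d x using that dspan_scale I by metis
  show "ideal I (ring_on D)"
  proof (rule idealI)
    show "subgroup I (add_monoid (ring_on D))"
    proof (rule R.add.subgroupI)
      show "I \<noteq> {}" using I dspan.zero by blast
      fix x y assume x: "x \<in> I" and y: "y \<in> I"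
      \<comment> \<open>\<open>dspan\<close> has no rule for negation; it is multiplication by -1
        \<in> D.\<close>
      have "- x \<in> I" using closed[OF uminus_mem[OF one_mem] x] by simp
      moreover have "x \<in> D" using I x by blast
      ultimately show "\<ominus>\<^bsub>ring_on D\<^esub> x \<in> I"
        using a_inv_ring_on by metis
      show "x \<oplus>\<^bsub>ring_on D\<^esub> y \<in> I" using x y I dspan.add by fastforce
    qed (use I in auto)
    show "x \<otimes>\<^bsub>ring_on D\<^esub> a \<in> I" "a \<otimes>\<^bsub>ring_on D\<^esub> x \<in> I"
      if "a \<in> I" "x \<in> carrier (ring_on D)" for a x
      using that closed[of x a] by (simp_all add: mult.commute)
  qed (rule R.ring_axioms)
qed

lemma d_star_ideal_iff: "d.star_ideal I \<longleftrightarrow> ideal I (ring_on D) \<and> I \<noteq> {0}"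
  by (auto simp: ideal_iff d.star_ideal_def)

lemma maximalideal_iff: "maximalideal M (ring_on D) \<longleftrightarrow> d.star_maximal M"
proof
  assume "maximalideal M (ring_on D)"
  then interpret maximalideal M "ring_on D" .
  \<comment> \<open>That D is not a field enters here: it prevents the zero ideal, which is never a
    \<open>star_ideal\<close>, from being maximal.\<close>
  have "M \<noteq> {0}"
  proof
    assume "M = {0}"
    then have "field (ring_on D)" using R.zeromaximalideal_eq_field is_maximalideal by simp
    then show False using not_field by blast
  qed
  then have "d.star_ideal M" using is_ideal by (simp add: d_star_ideal_iff)
  moreover have "I = M" if "d.star_ideal I" "I \<noteq> D" "M \<subseteq> I" for I
    using that I_maximal[of I] d.star_idealD(1) by (auto simp: d_star_ideal_iff)
  ultimately show "d.star_maximal M" using I_notcarr by (auto simp: d.star_maximal_def)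
next
  assume M: "d.star_maximal M"
  note M' = d.star_maximalD[OF M]
  show "maximalideal M (ring_on D)"
  proof (rule maximalidealI)
    fix J assume J: "ideal J (ring_on D)" "M \<subseteq> J" "J \<subseteq> carrier (ring_on D)"
    then have "d.star_ideal J"
      using d.star_idealD(3,5)[OF M'(1)] by (auto simp: d_star_ideal_iff)
    then show "J = M \<or> J = carrier (ring_on D)" using M'(5) J by auto
  qed (use M' in \<open>auto simp: d_star_ideal_iff\<close>)
qed

lemma primeideal_iff:
  "primeideal P (ring_on D) \<longleftrightarrow> P \<subseteq> D \<and> dspan D P = P \<and> 1 \<notin> P \<and>
     (\<forall>a\<in>D. \<forall>b\<in>D. a * b \<in> P \<longrightarrow> a \<in> P \<or> b \<in> P)"
proof
  assume "primeideal P (ring_on D)"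
  then interpret primeideal P "ring_on D" .
  show "P \<subseteq> D \<and> dspan D P = P \<and> 1 \<notin> P \<and> (\<forall>a\<in>D. \<forall>b\<in>D. a * b \<in> P \<longrightarrow> a \<in> P \<or> b \<in> P)"
    using is_ideal I_prime I_notcarr one_imp_carrier by (auto simp: ideal_iff)
next
  assume "P \<subseteq> D \<and> dspan D P = P \<and> 1 \<notin> P \<and> (\<forall>a\<in>D. \<forall>b\<in>D. a * b \<in> P \<longrightarrow> a \<in> P \<or> b \<in> P)"
  then show "primeideal P (ring_on D)"
    by (intro primeidealI R.is_cring) (auto simp: ideal_iff)
qed

lemma genideal_eq_dspan: "A \<subseteq> D \<Longrightarrow> Idl\<^bsub>ring_on D\<^esub> A = dspan D A"
proof (rule antisym)
  assume A: "A \<subseteq> D"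
  then have "ideal (dspan D A) (ring_on D)"
    using d.cl_subsetI[OF A d.cl_D] by (simp add: ideal_iff d.cl_idem)
  then show "Idl\<^bsub>ring_on D\<^esub> A \<subseteq> dspan D A"
    using subset_dspan by (intro R.genideal_minimal) auto
  show "dspan D A \<subseteq> Idl\<^bsub>ring_on D\<^esub> A"
    using R.genideal_ideal[of A] R.genideal_self[of A] A d.cl_subsetI by (auto simp: ideal_iff)
qed

text \<open>Multiplication by the inverse of a reduces this to cl {1} = D.\<close>

lemma (in star_operation) cl_singleton: "a \<noteq> 0 \<Longrightarrow> cl {a} = {a} * D"
proof (rule antisym)
  assume a: "a \<noteq> 0"
  show "{a} * D \<subseteq> cl {a}" using mult_cl[of _ "{1}" a] cl_one by (auto simp: set_times_def)
  show "cl {a} \<subseteq> {a} * D"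
  proof
    fix x assume "x \<in> cl {a}"
    then have "inverse a * x \<in> cl ({inverse a} * {a})" by (rule mult_cl)
    then have "inverse a * x \<in> D" using a by (simp add: cl_one set_times_def)
    then show "x \<in> {a} * D" using a by (auto intro: set_times_memI[of a])
  qed
qed

lemma dspan_singleton: "dspan D {a} = {a} * D"
proof (cases "a = 0")
  case True
  have "dspan D {0} \<subseteq> {0}" by (rule dspan_least) auto
  then show ?thesis using True zero_mem dspan.zero by (auto simp: set_times_def)
qed (simp add: d.cl_singleton)

lemma PIdl_eq: "a \<in> D \<Longrightarrow> PIdl\<^bsub>ring_on D\<^esub> a = {a} * D"
  using R.cgenideal_eq_genideal[of a] genideal_eq_dspan[of "{a}"] dspan_singleton by simp

lemma ideal_singleton_times: "a \<in> D \<Longrightarrow> ideal ({a} * D) (ring_on D)"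
  using R.cgenideal_ideal[of a] by (simp add: PIdl_eq)

lemma principalideal_iff: "principalideal I (ring_on D) \<longleftrightarrow> (\<exists>a\<in>D. I = {a} * D)"
proof
  assume "principalideal I (ring_on D)"
  then obtain a where "a \<in> D" "I = Idl\<^bsub>ring_on D\<^esub> {a}"
    using principalideal.generate by force
  then show "\<exists>a\<in>D. I = {a} * D"
    using genideal_eq_dspan[of "{a}"] by (auto simp: dspan_singleton)
next
  assume "\<exists>a\<in>D. I = {a} * D"
  then show "principalideal I (ring_on D)"
    using ideal_singleton_times by (auto intro!: principalidealI simp: genideal_eq_dspan dspan_singleton)
qed

text \<open>\<open>ideal_prod\<close> is generated by products and sums alone, without zero or
  scalars: 0 arises as 0 * 0, and a scalar from D is absorbed by the factor in I. Only the two
  operations matter, so one proof serves D and the quotient field.\<close>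

lemma ideal_prod_eq_dspan:
  assumes "D * I \<subseteq> I" "0 \<in> I" "0 \<in> J"
  shows "ideal_prod (ring_on D) I J = dspan D (I * J)"
    and "ideal_prod ring_of_type_algebra I J = dspan D (I * J)"
proof -
  have *: "ideal_prod R I J = dspan D (I * J)"
    if R: "\<And>x y. x \<otimes>\<^bsub>R\<^esub> y = x * y" "\<And>x y. x \<oplus>\<^bsub>R\<^esub> y = x + y" for R :: "'k ring"
  proof
    show "ideal_prod R I J \<subseteq> dspan D (I * J)"
    proof
      fix x assume "x \<in> ideal_prod R I J"
      then show "x \<in> dspan D (I * J)"
        by induction (use R subset_dspan[of "I * J"] dspan.add set_times_intro in auto)
    qed
    show "dspan D (I * J) \<subseteq> ideal_prod R I J"
    proof (rule dspan_least)
      show "I * J \<subseteq> ideal_prod R I J"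
        using ideal_prod.prod[of _ I _ J R] R(1) by (auto simp: set_times_def)
      show "0 \<in> ideal_prod R I J" using ideal_prod.prod[of 0 I 0 J R] assms R(1) by simp
      show "x + y \<in> ideal_prod R I J" if "x \<in> ideal_prod R I J" "y \<in> ideal_prod R I J" for x y
        using ideal_prod.sum[OF that] R(2) by simp
      show "d * x \<in> ideal_prod R I J" if d: "d \<in> D" and "x \<in> ideal_prod R I J" for d x
        using that(2)
      proof induction
        case (prod i j)
        have "d * i \<in> I" using d prod assms(1) by (auto simp: set_times_subset_iff)
        then show ?case using ideal_prod.prod[of "d * i" I j J R] prod by (simp add: R mult.assoc)
      next
        case (sum x y)
        then show ?case using ideal_prod.sum[of "d * x" R I J "d * y"] by (simp add: R distrib_left)
      qed
    qed
  qed
  show "ideal_prod (ring_on D) I J = dspan D (I * J)" by (rule *) simp_all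
  show "ideal_prod ring_of_type_algebra I J = dspan D (I * J)" by (rule *) simp_all
qed

lemma ideal_power_eq_dspan:
  assumes "ideal M (ring_on D)"
  shows "ideal_power D M n = dspan D (M ^ n)"
proof (induction n)
  case 0
  then show ?case by (simp add: ideals_set_def d.cl_one)
next
  case (Suc n)
  have "ideal_power D M (Suc n) = ideal_prod (ring_on D) (dspan D (M ^ n)) M"
    using Suc by (simp add: ideals_set_def)
  also have "\<dots> = dspan D (dspan D (M ^ n) * M)"
  proof (rule ideal_prod_eq_dspan)
    show "D * dspan D (M ^ n) \<subseteq> dspan D (M ^ n)" by (intro d.D_times_subset d.cl_idem)
    show "0 \<in> dspan D (M ^ n)" by (rule dspan.zero)
    show "0 \<in> M" using assms dspan.zero unfolding ideal_iff by metis
  qed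
  also have "\<dots> = dspan D (M ^ Suc n)" by (metis d.cl_times_cl_left mult.commute power_Suc)
  finally show ?case .
qed

section \<open>Fractional ideals and agreement of \<open>t_closure\<close> with
  \<open>tspan\<close>\<close>

lemma common_denominator:
  "finite S \<Longrightarrow> \<exists>d\<in>D - {0}. \<forall>x\<in>S. d * x \<in> D"
proof (induction rule: finite_induct)
  case (insert y S)
  then obtain d where d: "d \<in> D" "d \<noteq> 0" "\<forall>x\<in>S. d * x \<in> D" by auto
  obtain a b where ab: "a \<in> D" "b \<in> D" "b \<noteq> 0" "y = a / b" by (rule fractionE)
  have "(b * d) * x \<in> D" if "x \<in> S" for x
    using mult_mem[OF ab(2)] d(3) that by (auto simp: mult.assoc)
  moreover have "(b * d) * y \<in> D" using ab d by auto
  ultimately show ?case using ab d by (intro bexI[of _ "b * d"]) auto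
qed (use one_mem in auto)

lemma fractional_ideal_iff:
  "fractional_ideal D I \<longleftrightarrow> dspan D I = I \<and> (\<exists>d\<in>D - {0}. \<forall>x\<in>I. d * x \<in> D)"
proof -
  have "dspan D I = I \<longleftrightarrow> 0 \<in> I \<and> (\<forall>x\<in>I. \<forall>y\<in>I. x + y \<in> I) \<and> (\<forall>d\<in>D. \<forall>x\<in>I. d * x \<in> I)"
  proof
    assume I: "dspan D I = I"
    show "0 \<in> I \<and> (\<forall>x\<in>I. \<forall>y\<in>I. x + y \<in> I) \<and> (\<forall>d\<in>D. \<forall>x\<in>I. d * x \<in> I)"
      using dspan.zero[of D I] dspan.add[of _ D I] dspan_scale[of _ _ I] unfolding I by blast
  next
    assume "0 \<in> I \<and> (\<forall>x\<in>I. \<forall>y\<in>I. x + y \<in> I) \<and> (\<forall>d\<in>D. \<forall>x\<in>I. d * x \<in> I)"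
    then have "dspan D I \<subseteq> I" by (intro dspan_least) auto
    then show "dspan D I = I" using subset_dspan by blast
  qed
  then show ?thesis unfolding fractional_ideal_def by argo
qed

lemma d_star_ideal_fractional: "d.star_ideal I \<Longrightarrow> fractional_ideal D I"
  using one_mem by (force simp: fractional_ideal_iff d.star_ideal_def)

lemma dspan_finite:
  assumes "finite S"
  shows "dspan D S = {\<Sum>s\<in>S. c s * s | c. \<forall>s\<in>S. c s \<in> D}"
proof
  show "dspan D S \<subseteq> {\<Sum>s\<in>S. c s * s | c. \<forall>s\<in>S. c s \<in> D}" (is "_ \<subseteq> ?T")
  proof (rule dspan_least)
    show "S \<subseteq> ?T"
    proof
      fix x assume "x \<in> S"
      then have "(\<Sum>s\<in>S. (if s = x then 1 else 0) * s) = x"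
        using assms by (simp add: if_distrib[of "\<lambda>z. z * _"] cong: if_cong)
      then show "x \<in> ?T"
        by (intro CollectI exI[of _ "\<lambda>s. if s = x then 1 else 0"]) (auto split: if_splits)
    qed
    show "0 \<in> ?T" by (auto intro!: exI[of _ "\<lambda>_. 0"])
    fix x y assume "x \<in> ?T" "y \<in> ?T"
    then obtain c e where "\<forall>s\<in>S. c s \<in> D" "x = (\<Sum>s\<in>S. c s * s)" "\<forall>s\<in>S. e s \<in> D" "y = (\<Sum>s\<in>S. e s * s)"
      by blast
    then show "x + y \<in> ?T"
      by (auto intro!: exI[of _ "\<lambda>s. c s + e s"] simp: sum.distrib distrib_right)
  next
    fix d x assume d: "d \<in> D" and "x \<in> ?T"
    then obtain c where "\<forall>s\<in>S. c s \<in> D" "x = (\<Sum>s\<in>S. c s * s)" by blast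
    with d show "d * x \<in> ?T"
      by (intro CollectI exI[of _ "\<lambda>s. d * c s"]) (auto simp: sum_distrib_left mult.assoc)
  qed
  have "(\<Sum>s\<in>T. c s * s) \<in> dspan D S" if "finite T" "T \<subseteq> S" "\<forall>s\<in>S. c s \<in> D" for c T
    using that
  proof (induction rule: finite_induct)
    case (insert x F)
    then show ?case using dspan.scale[of "c x" D x S] by (auto intro: dspan.add)
  qed (auto intro: dspan.zero)
  then show "{\<Sum>s\<in>S. c s * s | c. \<forall>s\<in>S. c s \<in> D} \<subseteq> dspan D S" using assms by blast
qed

lemma fg_fractional_ideal_iff:
  "fg_fractional_ideal D I \<longleftrightarrow> (\<exists>S. finite S \<and> I = dspan D S)"
proof
  assume "fg_fractional_ideal D I"
  then obtain S where "finite S" "I = {\<Sum>s\<in>S. c s * s | c. \<forall>s\<in>S. c s \<in> D}"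
    unfolding fg_fractional_ideal_def by blast
  then show "\<exists>S. finite S \<and> I = dspan D S" using dspan_finite by blast
next
  assume "\<exists>S. finite S \<and> I = dspan D S"
  then obtain S where S: "finite S" "I = dspan D S" by blast
  obtain d where d: "d \<in> D - {0}" "\<forall>x\<in>S. d * x \<in> D" using common_denominator[OF S(1)] by blast
  have "dspan D S \<subseteq> {x. d * x \<in> D}"
    using d(2) by (intro dspan_least) (auto simp: distrib_left mult.left_commute)
  then have "fractional_ideal D I"
    using d(1) S(2) d.cl_idem[of S] unfolding fractional_ideal_iff by blast
  moreover have "I = {\<Sum>s\<in>S. c s * s | c. \<forall>s\<in>S. c s \<in> D}" using S dspan_finite by simp
  ultimately show "fg_fractional_ideal D I" using S(1) unfolding fg_fractional_ideal_def by blast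
qed

lemma v_closure_dspan: "v_closure D (dspan D S) = v_closure D S"
  by (simp add: v_closure_def d.frac_inverse_cl)

lemma t_closure_eq_tspan:
  assumes "dspan D I = I" "I \<noteq> {0}"
  shows "t_closure D I = tspan D I"
proof
  show "t_closure D I \<subseteq> tspan D I"
  proof
    fix x assume "x \<in> t_closure D I"
    then obtain J where J: "x \<in> v_closure D J" "J \<subseteq> I" "fg_fractional_ideal D J"
      by (auto simp: t_closure_def)
    then obtain S where "finite S" "J = dspan D S" by (auto simp: fg_fractional_ideal_iff)
    then show "x \<in> tspan D I"
      using J subset_dspan[of S] by (auto simp: mem_tspan_iff v_closure_dspan)
  qed
  show "tspan D I \<subseteq> t_closure D I"
  proof
    fix x assume "x \<in> tspan D I"
    then obtain F where F: "finite F" "F \<subseteq> I" "x \<in> v_closure D F" by (auto simp: mem_tspan_iff)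
    \<comment> \<open>F may be empty or {0}, whereas \<open>t_closure\<close> ranges over nonzero J
      only; adding a nonzero element of I repairs this.\<close>
    obtain a where a: "a \<in> I" "a \<noteq> 0" using assms dspan.zero by blast
    let ?J = "dspan D (insert a F)"
    have "?J \<subseteq> I" using assms(1) a F by (intro d.cl_subsetI) auto
    moreover have "?J \<noteq> {0}" using subset_dspan[of "insert a F"] a by auto
    moreover have "x \<in> v_closure D ?J"
      using F(3) v_closure_mono[of F "insert a F" D] by (auto simp: v_closure_dspan)
    moreover have "fg_fractional_ideal D ?J" using F(1) fg_fractional_ideal_iff by blast
    ultimately show "x \<in> t_closure D I" unfolding t_closure_def by blast
  qed
qed

lemma t_ideal_iff: "t_ideal D I \<and> I \<subseteq> D \<longleftrightarrow> t.star_ideal I"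
proof
  assume "t_ideal D I \<and> I \<subseteq> D"
  then show "t.star_ideal I"
    using t_closure_eq_tspan[of I] unfolding t_ideal_def t.star_ideal_def fractional_ideal_iff by metis
next
  assume I: "t.star_ideal I"
  then have d: "d.star_ideal I" by (rule t_star_ideal_imp_d)
  then show "t_ideal D I \<and> I \<subseteq> D"
    using I t_closure_eq_tspan[of I] d_star_ideal_fractional[of I]
    unfolding t_ideal_def t.star_ideal_def fractional_ideal_iff by metis
qed

lemma maximal_t_ideal_iff: "maximal_t_ideal D M \<longleftrightarrow> t.star_maximal M"
  using t_ideal_iff unfolding maximal_t_ideal_def t.star_maximal_def psubset_eq by metis

lemma ideal_times_frac_inverse:
  assumes "d.star_ideal I"
  shows "ideal_prod ring_of_type_algebra I (frac_inverse D I) = dspan D (I * frac_inverse D I)"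
proof (rule ideal_prod_eq_dspan(2))
  show "D * I \<subseteq> I" using assms d.star_idealD(2) d.D_times_subset by blast
  show "0 \<in> I" using assms d.star_idealD by blast
  show "0 \<in> frac_inverse D I" by (simp add: frac_inverse_def)
qed

lemma (in star_operation) star_invertible_iff:
  "star_invertible I \<longleftrightarrow> cl (I * frac_inverse D I) = D"
  using cl_mono[OF times_frac_inverse_subset[of I D]] cl_D cl_one
  unfolding star_invertible_def
  by (metis cl_subset_iff empty_subsetI insert_subset one_mem subset_antisym)

lemma invertible_ideal_iff:
  "d.star_ideal I \<Longrightarrow> invertible_ideal D I \<longleftrightarrow> d.star_invertible I"
  using d_star_ideal_fractional d.star_idealD(4) ideal_times_frac_inverse
  unfolding invertible_ideal_def d.star_invertible_iff by metis

lemma t_invertible_ideal_iff: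
  assumes "d.star_ideal I"
  shows "t_invertible_ideal D I \<longleftrightarrow> t.star_invertible I"
proof -
  let ?J = "dspan D (I * frac_inverse D I)"
  obtain a where a: "a \<in> I" "a \<noteq> 0" using d.star_idealD(5)[OF assms] by blast
  \<comment> \<open>I I^-1 contains I and hence is nonzero, as the comparison of
    \<open>t_closure\<close> with \<open>tspan\<close> requires.\<close>
  have "1 \<in> frac_inverse D I" using d.star_idealD(1)[OF assms] by (auto simp: frac_inverse_def)
  then have "a * 1 \<in> I * frac_inverse D I" using a by (intro set_times_intro)
  then have "a * 1 \<in> ?J" by (rule subsetD[OF subset_dspan])
  then have "?J \<noteq> {0}" using a by auto
  then have "t_closure D ?J = tspan D (I * frac_inverse D I)"
    using t_closure_eq_tspan[of ?J] by (simp add: d.cl_idem tspan_dspan)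
  then show ?thesis
    using assms d_star_ideal_fractional d.star_idealD(4) ideal_times_frac_inverse
    unfolding t_invertible_ideal_def t.star_invertible_iff by metis
qed

end

lemma singleton_times_singleton [simp]: "{a :: 'a::times} * {b} = {a * b}"
  by (auto simp: set_times_def)

lemma one_mem_v_closure_iff: "1 \<in> v_closure D S \<longleftrightarrow> frac_inverse D S \<subseteq> D"
  by (auto simp: v_closure_def frac_inverse_def[of D "frac_inverse D S"])

section \<open>Star operations under which all ideals are good\<close>

context star_operation
begin

theorem all_star_ideals_good_iff:
  assumes "P D"
    and "\<And>I J. star_ideal I \<Longrightarrow> star_ideal J \<Longrightarrow> P I \<Longrightarrow> P J \<Longrightarrow> P (cl (I * J))"
    and inv: "\<And>I. star_ideal I \<Longrightarrow> P I \<Longrightarrow> star_invertible I"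
  shows "(\<forall>I. star_ideal I \<longrightarrow> P I) \<longleftrightarrow>
    (\<forall>M. star_maximal M \<longrightarrow> P M \<and> (\<Inter>n\<in>{1..}. cl (M ^ n)) = {0})"
proof
  assume *: "\<forall>M. star_maximal M \<longrightarrow> P M \<and> (\<Inter>n\<in>{1..}. cl (M ^ n)) = {0}"
  show "\<forall>I. star_ideal I \<longrightarrow> P I"
  proof (intro allI impI)
    fix I assume I: "star_ideal I"
    have max: "P M" "(\<Inter>n\<in>{1..}. cl (M ^ n)) = {0}" if "star_maximal M" for M
      using that * by auto
    show "P I" by (rule star_ideals_good[OF assms max I])
  qed
next
  assume "\<forall>I. star_ideal I \<longrightarrow> P I"
  then show "\<forall>M. star_maximal M \<longrightarrow> P M \<and> (\<Inter>n\<in>{1..}. cl (M ^ n)) = {0}"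
    using Inter_powers_eq_0 inv star_maximalD(1,2) by meson
qed

lemma star_invertible_D: "star_invertible D"
proof -
  have "1 \<in> frac_inverse D D" by (auto simp: frac_inverse_def)
  then have "1 * 1 \<in> D * frac_inverse D D" by (intro set_times_intro) auto
  then show ?thesis using subset_cl by (auto simp: star_invertible_def)
qed

lemma star_invertible_cl: "star_invertible (cl I) \<longleftrightarrow> star_invertible I"
  by (simp add: star_invertible_def frac_inverse_cl cl_times_cl_left)

lemma star_invertible_times:
  assumes "star_invertible I" "star_invertible J"
  shows "star_invertible (I * J)"
proof -
  have "1 * 1 \<in> cl (I * frac_inverse D I) * cl (J * frac_inverse D J)"
    using assms unfolding star_invertible_def by (intro set_times_intro)
  also have "\<dots> \<subseteq> cl (I * frac_inverse D I * (J * frac_inverse D J))" by (rule times_cl_subset)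
  also have "I * frac_inverse D I * (J * frac_inverse D J) =
      (I * J) * (frac_inverse D I * frac_inverse D J)"
    by (simp only: mult_ac)
  also have "frac_inverse D I * frac_inverse D J \<subseteq> frac_inverse D (I * J)"
  proof (unfold set_times_subset_iff, intro ballI)
    fix x y assume xy: "x \<in> frac_inverse D I" "y \<in> frac_inverse D J"
    have "x * y * (a * b) \<in> D" if "a \<in> I" "b \<in> J" for a b
      using mult_mem[OF frac_inverse_memD[OF xy(1) that(1)] frac_inverse_memD[OF xy(2) that(2)]]
      by (simp add: mult_ac)
    then show "x * y \<in> frac_inverse D (I * J)" by (auto simp: frac_inverse_def set_times_def)
  qed
  then have "cl ((I * J) * (frac_inverse D I * frac_inverse D J)) \<subseteq> cl ((I * J) * frac_inverse D (I * J))"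
    by (intro cl_mono set_times_mono2 order_refl)
  finally show ?thesis by (simp add: star_invertible_def)
qed

lemma star_invertible_power: "star_invertible I \<Longrightarrow> star_invertible (I ^ n)"
proof (induction n)
  case 0
  then show ?case using star_invertible_D star_invertible_cl[of "{1}"] cl_one by simp
qed (simp add: star_invertible_times)

lemma v_closure_star_invertible:
  assumes "star_invertible I"
  shows "v_closure D I = cl I"
proof -
  have "v_closure D (cl I) = cl I"
    using assms by (intro star_invertible_v_closure) (simp_all add: star_invertible_cl cl_idem)
  then show ?thesis by (simp add: v_closure_def frac_inverse_cl)
qed

end

context domain_in_field
begin

text \<open>Both sides are the v-closure of I. This lets ordinary powers of an invertible M stand
  for their t-closures.\<close>

lemma d_invertible_tspan: "d.star_invertible I \<Longrightarrow> tspan D I = dspan D I"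
  using d.v_closure_star_invertible t.v_closure_star_invertible d_invertible_imp_t by metis

section \<open>Principal ideal domains and factorial domains\<close>

lemma singleton_times_invertible:
  assumes "a \<noteq> 0"
  shows "d.star_invertible ({a} * D)"
proof -
  have "inverse a \<in> frac_inverse D ({a} * D)"
    using assms by (auto simp: frac_inverse_def set_times_def simp flip: mult.assoc)
  moreover have "a * 1 \<in> {a} * D" by (rule set_times_intro) auto
  ultimately have "a * 1 * inverse a \<in> {a} * D * frac_inverse D ({a} * D)" by (rule set_times_intro[rotated])
  then show ?thesis using assms subset_dspan by (auto simp: d.star_invertible_def)
qed

lemma (in star_operation) principal_ideal_nonzero:
  "star_ideal I \<Longrightarrow> I = {a} * D \<Longrightarrow> a \<noteq> 0"
  using star_idealD(5)[of I] by (auto simp: set_times_def)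

lemma (in star_operation) principal_times:
  assumes "star_ideal I" "star_ideal J" "\<exists>a\<in>D. I = {a} * D" "\<exists>b\<in>D. J = {b} * D"
  shows "\<exists>c\<in>D. cl (I * J) = {c} * D"
proof -
  obtain a b where ab: "a \<in> D" "b \<in> D" "I = {a} * D" "J = {b} * D" using assms by blast
  then have "a \<noteq> 0" "b \<noteq> 0" using assms(1,2) principal_ideal_nonzero by auto
  then have "cl (I * J) = cl (cl {a} * cl {b})" by (simp add: ab cl_singleton)
  also have "\<dots> = cl {a * b}" by (subst cl_times_cl) simp
  also have "\<dots> = {a * b} * D" using \<open>a \<noteq> 0\<close> \<open>b \<noteq> 0\<close> by (simp add: cl_singleton)
  finally show ?thesis using ab by blast
qed

lemma (in star_operation) D_principal: "\<exists>a\<in>D. D = {a} * D"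
  by (intro bexI[of _ 1]) auto

lemma d_star_ideals_principal_iff:
  "(\<forall>I. d.star_ideal I \<longrightarrow> (\<exists>a\<in>D. I = {a} * D)) \<longleftrightarrow>
   (\<forall>M. d.star_maximal M \<longrightarrow> (\<exists>a\<in>D. M = {a} * D) \<and> (\<Inter>n\<in>{1..}. dspan D (M ^ n)) = {0})"
  using d.all_star_ideals_good_iff[of "\<lambda>I. \<exists>a\<in>D. I = {a} * D", OF d.D_principal d.principal_times]
    singleton_times_invertible d.principal_ideal_nonzero by blast

lemma t_star_ideals_principal_iff:
  "(\<forall>I. t.star_ideal I \<longrightarrow> (\<exists>a\<in>D. I = {a} * D)) \<longleftrightarrow>
   (\<forall>M. t.star_maximal M \<longrightarrow> (\<exists>a\<in>D. M = {a} * D) \<and> (\<Inter>n\<in>{1..}. tspan D (M ^ n)) = {0})"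
  using t.all_star_ideals_good_iff[of "\<lambda>I. \<exists>a\<in>D. I = {a} * D", OF t.D_principal t.principal_times]
    d_invertible_imp_t[OF singleton_times_invertible] t.principal_ideal_nonzero by blast

lemma principal_domain_iff:
  "principal_domain (ring_on D) \<longleftrightarrow> (\<forall>I. d.star_ideal I \<longrightarrow> (\<exists>a\<in>D. I = {a} * D))"
proof
  assume "principal_domain (ring_on D)"
  then interpret principal_domain "ring_on D" .
  show "\<forall>I. d.star_ideal I \<longrightarrow> (\<exists>a\<in>D. I = {a} * D)"
    using exists_gen PIdl_eq by (fastforce simp: d_star_ideal_iff)
next
  assume principal: "\<forall>I. d.star_ideal I \<longrightarrow> (\<exists>a\<in>D. I = {a} * D)"
  show "principal_domain (ring_on D)"
  proof (intro principal_domain.intro principal_domain_axioms.intro domain_ring_on)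
    fix I assume I: "ideal I (ring_on D)"
    have "{0} = {0} * D" using zero_mem by (auto simp: set_times_def)
    then have "\<exists>a\<in>D. I = {a} * D"
      using principal I zero_mem by (cases "I = {0}") (auto simp: d_star_ideal_iff)
    then show "\<exists>a\<in>carrier (ring_on D). I = PIdl\<^bsub>ring_on D\<^esub> a" using PIdl_eq by auto
  qed
qed

section \<open>Factorial domains and the t-operation\<close>

lemma divides_iff: "a divides\<^bsub>mult_of (ring_on D)\<^esub> b \<longleftrightarrow> (\<exists>c\<in>D - {0}. b = a * c)"
  by (simp add: factor_def)

lemma divides_iff_subset:
  assumes "a \<in> D - {0}" "b \<in> D - {0}"
  shows "a divides\<^bsub>mult_of (ring_on D)\<^esub> b \<longleftrightarrow> {b} * D \<subseteq> {a} * D"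
proof
  assume "a divides\<^bsub>mult_of (ring_on D)\<^esub> b"
  then obtain c where "c \<in> D" "b = a * c" by (auto simp: divides_iff)
  then show "{b} * D \<subseteq> {a} * D" by (auto simp: set_times_def mult.assoc)
next
  assume "{b} * D \<subseteq> {a} * D"
  moreover have "b * 1 \<in> {b} * D" by (rule set_times_intro) auto
  ultimately have "b \<in> {a} * D" by auto
  then obtain c where "c \<in> D" "b = a * c" unfolding mem_singleton_times by blast
  then show "a divides\<^bsub>mult_of (ring_on D)\<^esub> b" using assms(2) by (auto simp: divides_iff)
qed

text \<open>Factoriality is split into the divisor chain condition and the existence of gcds. Proper
  divisors generate strictly larger principal ideals, so \<open>t.star_induct\<close> yields the
  first; a generator of the t-closure of {a, b} is a gcd of a and b.\<close>

lemma factorial_domainI: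
  assumes principal: "\<And>I. t.star_ideal I \<Longrightarrow> \<exists>a\<in>D. I = {a} * D"
  shows "factorial_domain (ring_on D)"
proof -
  let ?G = "mult_of (ring_on D)"
  let ?r = "{(x, y). x \<in> carrier ?G \<and> y \<in> carrier ?G \<and> properfactor ?G x y}"
  have star: "t.star_ideal ({a} * D)" if "a \<in> D" "a \<noteq> 0" for a
    using t.star_idealI[of "{a}" a] that by (simp add: t.cl_singleton)
  \<comment> \<open>Accessibility of every generator of I transfers the induction over ideals to the
    divisibility order on elements.\<close>
  define Q where "Q I \<longleftrightarrow> (\<forall>a\<in>D - {0}. I = {a} * D \<longrightarrow> a \<in> Wellfounded.acc ?r)" for I
  have fin: "\<exists>F. finite F \<and> F \<subseteq> I \<and> tspan D F = I" if I: "t.star_ideal I" for I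
  proof -
    obtain a where "a \<in> D" "I = {a} * D" using principal I by blast
    then have *: "I = tspan D {a}" using t.principal_ideal_nonzero[OF I] by (simp add: t.cl_singleton)
    moreover have "{a} \<subseteq> I" unfolding * by (rule t.subset_cl)
    ultimately show ?thesis by (metis finite.emptyI finite.insertI)
  qed
  have step: "Q I" if IH: "\<And>J. t.star_ideal J \<Longrightarrow> I \<subset> J \<Longrightarrow> Q J" for I
    unfolding Q_def
  proof (intro ballI impI, rule accI)
    fix a y assume a: "a \<in> D - {0}" "I = {a} * D" and y: "(y, a) \<in> ?r"
    then have "I \<subset> {y} * D" by (auto simp: properfactor_def divides_iff_subset)
    then have "Q ({y} * D)" using y star by (intro IH) auto
    then show "y \<in> Wellfounded.acc ?r" using y unfolding Q_def by simp
  qed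
  have acc: "Q I" if "t.star_ideal I" for I
    using that by (rule t.star_induct[of Q, OF fin step, rotated -1])
  have "a \<in> Wellfounded.acc ?r" for a
  proof (cases "a \<in> D - {0}")
    case True
    then show ?thesis using acc[OF star] unfolding Q_def by blast
  qed (rule accI, auto)
  then have "wf ?r" by (intro acc_wfI) blast
  then have "divisor_chain_condition_monoid ?G"
    by (intro divisor_chain_condition_monoid.intro divisor_chain_condition_monoid_axioms.intro
        R.mult_of.comm_monoid_cancel_axioms)
  moreover have "\<exists>c. c \<in> carrier ?G \<and> c gcdof\<^bsub>?G\<^esub> a b" if ab: "a \<in> carrier ?G" "b \<in> carrier ?G" for a b
  proof -
    \<comment> \<open>The t-closure of {a, b} lies in every principal ideal containing a and b,
      because principal ideals are t-closed; so its generator is divisible by every common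
      divisor.\<close>
    have tstar: "t.star_ideal (tspan D {a, b})" using ab by (intro t.star_idealI[of _ a]) auto
    then obtain c where c: "c \<in> D" "tspan D {a, b} = {c} * D" using principal by blast
    have "c \<noteq> 0" using t.principal_ideal_nonzero[OF tstar c(2)] .
    have sub: "{y} * D \<subseteq> {c} * D" if "y \<in> {a, b}" "y \<noteq> 0" for y
      using that c(2) t.cl_mono[of "{y}" "{a, b}"] by (auto simp flip: t.cl_singleton)
    have "{c} * D \<subseteq> {y} * D" if y: "y \<in> D - {0}" "{a} * D \<subseteq> {y} * D" "{b} * D \<subseteq> {y} * D" for y
    proof -
      have "{a, b} \<subseteq> {y} * D" using y(2,3) ab t.subset_cl[of "{a}"] t.subset_cl[of "{b}"]
        by (auto simp: t.cl_singleton)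
      then have "tspan D {a, b} \<subseteq> {y} * D" using t.star_idealD(2)[OF star] y(1) by (intro t.cl_subsetI) auto
      then show ?thesis using c(2) by simp
    qed
    then have "c gcdof\<^bsub>?G\<^esub> a b"
      using ab c(1) \<open>c \<noteq> 0\<close> sub unfolding isgcd_def by (auto simp: divides_iff_subset)
    then show ?thesis using c(1) \<open>c \<noteq> 0\<close> by auto
  qed
  then have "gcd_condition_monoid ?G"
    by (intro gcd_condition_monoid.intro gcd_condition_monoid_axioms.intro R.mult_of.comm_monoid_cancel_axioms)
  ultimately have "factorial_monoid ?G" by (simp flip: factorial_condition_two)
  then show ?thesis by (intro factorial_domain.intro domain_ring_on)
qed

text \<open>A nonzero element of P is a product of irreducibles, these are prime elements, and P
  must contain one of them.\<close>

lemma factorial_prime_ideal: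
  assumes "factorial_domain (ring_on D)" and P: "primeideal P (ring_on D)" "P \<noteq> {0}"
  obtains p where "p \<in> P" "p \<noteq> 0" "primeideal ({p} * D) (ring_on D)"
proof -
  interpret factorial_domain "ring_on D" by fact
  let ?G = "mult_of (ring_on D)"
  note P' = P(1)[unfolded primeideal_iff]
  have "0 \<in> P" using P' dspan.zero by metis
  then obtain m where m: "m \<in> P" "m \<noteq> 0" using P(2) by blast
  have "m \<notin> Units ?G"
  proof
    assume "m \<in> Units ?G"
    then have "inverse m * m \<in> P" using m P' dspan_scale[of "inverse m" m P] by (auto simp: Units_ring_on)
    then show False using m P' by simp
  qed
  then obtain fs where fs: "set fs \<subseteq> D - {0}" "factors ?G fs m"
    using factors_exist[of m] m P' by auto
  have "\<exists>p\<in>set fs. p \<in> P" if "set fs \<subseteq> D" "foldr (*) fs 1 \<in> P" for fs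
    using that
  proof (induction fs)
    case (Cons f fs)
    have "foldr (*) fs 1 \<in> D" using Cons(2) by (induction fs) auto
    then have "f \<in> P \<or> foldr (*) fs 1 \<in> P" using Cons(2,3) P' by simp
    then show ?case using Cons by auto
  qed (use P' in auto)
  moreover have "foldr (\<otimes>\<^bsub>?G\<^esub>) fs 1 = foldr (*) fs 1" by (induction fs) auto
  then have "foldr (*) fs 1 \<in> P" using fs(2) m by (simp add: factors_def)
  ultimately obtain p where p: "p \<in> set fs" "p \<in> P" using fs(1) by blast
  then have pD: "p \<in> D" "p \<noteq> 0" using fs(1) by auto
  have "Divisibility.irreducible ?G p" using p fs(2) by (simp add: factors_def)
  then have "Divisibility.prime ?G p" using irreducible_prime pD by auto
  then have "ring_prime\<^bsub>ring_on D\<^esub> p" using R.ring_primeI' pD by auto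
  then have "primeideal (PIdl\<^bsub>ring_on D\<^esub> p) (ring_on D)" using R.primeideal_iff_prime pD by auto
  then show ?thesis using that p pD by (simp add: PIdl_eq)
qed

lemma t_star_maximal_primeideal: "t.star_maximal M \<Longrightarrow> primeideal M (ring_on D)"
  using t.star_maximalD(1,3,4)[of M] t.star_maximal_prime[of M] t_star_ideal_imp_d d.star_idealD(2)
  unfolding primeideal_iff by blast

text \<open>Suppose y \<in> M is outside pD, and x p and x y are in D. Then (x p) y is in pD, so x p
  is in pD by primeness and x is in D. Hence {p, y}^-1 lies in D and 1 is in {p, y}_v \<subseteq> M,
  a contradiction.\<close>

lemma prime_element_t_maximal:
  assumes p: "primeideal ({p} * D) (ring_on D)" "p \<noteq> 0" and M: "t.star_maximal M" "p \<in> M"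
  shows "M = {p} * D"
proof
  note M' = t.star_maximalD[OF M(1)]
  note p' = p(1)[unfolded primeideal_iff]
  have "{p} \<subseteq> M" using M by simp
  then show "{p} * D \<subseteq> M"
    using p t.cl_subsetI[of "{p}" M] t.star_idealD(2)[OF M'(1)] by (simp add: t.cl_singleton)
  show "M \<subseteq> {p} * D"
  proof (rule ccontr)
    assume "\<not> M \<subseteq> {p} * D"
    then obtain y where y: "y \<in> M" "y \<notin> {p} * D" by blast
    have "frac_inverse D {p, y} \<subseteq> D"
    proof
      fix x assume x: "x \<in> frac_inverse D {p, y}"
      have xD: "x * p \<in> D" "x * y \<in> D" using x by (auto simp: frac_inverse_def)
      have "(x * p) * y \<in> {p} * D" using xD by (auto simp: set_times_def mult_ac)
      then have "x * p \<in> {p} * D" using y xD M' p' by blast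
      then show "x \<in> D" using p by (auto simp: set_times_def)
    qed
    then have "1 \<in> v_closure D {p, y}" by (simp add: one_mem_v_closure_iff)
    moreover have "v_closure D {p, y} \<subseteq> tspan D {p, y}" by (rule v_closure_subset_tspan) simp
    moreover have "tspan D {p, y} \<subseteq> M"
      using M y t.star_idealD(2)[OF M'(1)] by (intro t.cl_subsetI) auto
    ultimately show False using M' by blast
  qed
qed

lemma (in star_operation) cl_singleton_times_power:
  assumes "a \<noteq> 0"
  shows "cl (({a} * D) ^ n) = {a ^ n} * D"
proof (induction n)
  case (Suc n)
  have "cl (({a} * D) ^ Suc n) = cl (cl {a} * cl (({a} * D) ^ n))"
    using assms by (simp add: cl_times_cl_right cl_singleton)
  also have "\<dots> = cl ({a} * {a ^ n})" using Suc assms by (simp add: cl_times_cl flip: cl_singleton)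
  also have "{a} * {a ^ n} = {a ^ Suc n}" by (auto simp: set_times_def)
  finally show ?case using assms by (simp add: cl_singleton)
qed (simp add: cl_one)

text \<open>A nonzero x divisible by all powers of p would yield the infinite chain x/p, x/p^2, ...
  of proper divisors.\<close>

lemma factorial_domain_Inter_powers:
  assumes "factorial_domain (ring_on D)" and p: "p \<in> D" "p \<noteq> 0" "inverse p \<notin> D"
  shows "(\<Inter>n\<in>{1..}. {p ^ n} * D) = {0}"
proof (rule ccontr)
  interpret factorial_domain "ring_on D" by fact
  let ?G = "mult_of (ring_on D)"
  have "0 \<in> {p ^ n} * D" for n by (rule set_times_memI[of "p ^ n" _ 0]) auto
  moreover assume "(\<Inter>n\<in>{1..}. {p ^ n} * D) \<noteq> {0}"
  ultimately obtain x where x: "x \<noteq> 0" "\<And>n. n \<ge> 1 \<Longrightarrow> x \<in> {p ^ n} * D" by blast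
  define y where "y n = x / p ^ Suc n" for n
  have y: "y n \<in> D - {0}" for n using x(1) x(2)[of "Suc n"] p by (auto simp: y_def set_times_def)
  have y_Suc: "y n = y (Suc n) * p" for n using p by (simp add: y_def field_simps)
  have "properfactor ?G (y (Suc n)) (y n)" for n
    unfolding properfactor_def
  proof
    show "y (Suc n) divides\<^bsub>?G\<^esub> y n" using y_Suc[of n] p by (auto simp: divides_iff)
    show "\<not> y n divides\<^bsub>?G\<^esub> y (Suc n)"
    proof
      assume "y n divides\<^bsub>?G\<^esub> y (Suc n)"
      then obtain c where c: "c \<in> D" "y (Suc n) = y n * c" by (auto simp: divides_iff)
      then have "y (Suc n) * (p * c) = y (Suc n) * 1" using y_Suc[of n] by (simp add: mult_ac)
      then have "p * c = 1" using y[of "Suc n"] by simp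
      then show False using c p inverse_unique by blast
    qed
  qed
  then show False
    using division_wellfounded y unfolding wf_iff_no_infinite_down_chain by auto
qed

text \<open>For a UFD the criterion on maximal t-ideals is itself applied: such an ideal contains a
  prime element p, equals pD, and its powers p^n D meet in zero.\<close>

theorem factorial_domain_iff:
  "factorial_domain (ring_on D) \<longleftrightarrow> (\<forall>I. t.star_ideal I \<longrightarrow> (\<exists>a\<in>D. I = {a} * D))"
proof
  assume UFD: "factorial_domain (ring_on D)"
  show "\<forall>I. t.star_ideal I \<longrightarrow> (\<exists>a\<in>D. I = {a} * D)"
    unfolding t_star_ideals_principal_iff
  proof (intro allI impI)
    fix M assume M: "t.star_maximal M"
    note M' = t.star_maximalD[OF M]
    obtain p where p: "p \<in> M" "p \<noteq> 0" "primeideal ({p} * D) (ring_on D)"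
      using factorial_prime_ideal[OF UFD t_star_maximal_primeideal[OF M]] M'(1) t.star_idealD(4) by metis
    then have MpD: "M = {p} * D" using prime_element_t_maximal M by blast
    have "inverse p \<notin> D"
      using M'(3) p(2) by (auto simp: MpD set_times_def)
    then have "(\<Inter>n\<in>{1..}. {p ^ n} * D) = {0}"
      using factorial_domain_Inter_powers[OF UFD] p M'(4) by blast
    then show "(\<exists>a\<in>D. M = {a} * D) \<and> (\<Inter>n\<in>{1..}. tspan D (M ^ n)) = {0}"
      using MpD p M'(4) by (auto simp: t.cl_singleton_times_power)
  qed
qed (use factorial_domainI in blast)

end

section \<open>Dedekind domains\<close>

lemma (in star_operation) sum_cl: "(\<And>i. i \<in> A \<Longrightarrow> f i \<in> cl S) \<Longrightarrow> sum f A \<in> cl S"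
  by (induction A rule: infinite_finite_induct) (auto intro: zero_cl add_cl)

text \<open>x = x * 1 lies in the closure of (x I) I^-1 \<subseteq> I I^-1 \<subseteq> D. With I
  invertible this takes the place of the determinant trick.\<close>

lemma (in star_operation) multiplier_of_invertible:
  assumes "star_invertible I" "{x} * I \<subseteq> I"
  shows "x \<in> D"
proof -
  have "x * 1 \<in> cl ({x} * (I * frac_inverse D I))"
    using assms(1) unfolding star_invertible_def by (rule mult_cl)
  then have x: "x \<in> cl ({x} * I * frac_inverse D I)" by (simp add: mult.assoc)
  have "{x} * I * frac_inverse D I \<subseteq> I * frac_inverse D I" using assms(2) by (rule set_times_mono2) simp
  also have "\<dots> \<subseteq> D" by (rule times_frac_inverse_subset)
  finally have "cl ({x} * I * frac_inverse D I) \<subseteq> D" using cl_D by (rule cl_subsetI)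
  then show ?thesis using x by blast
qed

context domain_in_field
begin

lemma noetherian_domain_iff:
  "noetherian_domain (ring_on D) \<longleftrightarrow>
     (\<forall>I. d.star_ideal I \<longrightarrow> (\<exists>F. finite F \<and> F \<subseteq> I \<and> dspan D F = I))"
proof
  assume "noetherian_domain (ring_on D)"
  then interpret noetherian_domain "ring_on D" .
  show "\<forall>I. d.star_ideal I \<longrightarrow> (\<exists>F. finite F \<and> F \<subseteq> I \<and> dspan D F = I)"
  proof (intro allI impI)
    fix I assume "d.star_ideal I"
    then obtain F where "F \<subseteq> D" "finite F" "I = Idl\<^bsub>ring_on D\<^esub> F"
      using finetely_gen[of I] by (auto simp: d_star_ideal_iff)
    then show "\<exists>F. finite F \<and> F \<subseteq> I \<and> dspan D F = I"
      using genideal_eq_dspan subset_dspan by metis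
  qed
next
  assume fin: "\<forall>I. d.star_ideal I \<longrightarrow> (\<exists>F. finite F \<and> F \<subseteq> I \<and> dspan D F = I)"
  show "noetherian_domain (ring_on D)"
  proof (intro noetherian_domain.intro domain_ring_on noetherian_ring.intro R.ring_axioms
      noetherian_ring_axioms.intro)
    fix I assume I: "ideal I (ring_on D)"
    have "\<exists>F. finite F \<and> F \<subseteq> I \<and> dspan D F = I"
    proof (cases "I = {0}")
      case True
      have "dspan D {} = {0}" using dspan_least[of "{}" "{0}"] dspan.zero by auto
      then show ?thesis using True by (intro exI[of _ "{}"]) auto
    qed (use fin I in \<open>simp add: d_star_ideal_iff\<close>)
    then obtain F where F: "finite F" "F \<subseteq> I" "dspan D F = I" by blast
    moreover have "F \<subseteq> D" using F I by (auto simp: ideal_iff)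
    ultimately show "\<exists>A\<subseteq>carrier (ring_on D). finite A \<and> I = Idl\<^bsub>ring_on D\<^esub> A"
      using genideal_eq_dspan by auto
  qed
qed

text \<open>A common denominator d of 1, x, ..., x^(n-1) turns the module they span into a nonzero
  ideal of D. The integral equation makes this ideal stable under x, and an invertible ideal has
  only multipliers from D.\<close>

lemma invertible_imp_integrally_closed:
  assumes inv: "\<And>I. d.star_ideal I \<Longrightarrow> d.star_invertible I"
  shows "integrally_closed_domain D"
  unfolding integrally_closed_domain_def
proof (intro allI impI)
  fix x :: 'k and n :: nat and c
  assume n: "0 < n" and c: "\<forall>i<n. c i \<in> D" and eq: "x ^ n + (\<Sum>i<n. c i * x ^ i) = 0"
  obtain d where d: "d \<in> D - {0}" "\<forall>y\<in>(\<lambda>i. x ^ i) ` {..<n}. d * y \<in> D"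
    using common_denominator[of "(\<lambda>i. x ^ i) ` {..<n}"] by blast
  let ?S = "(\<lambda>i. d * x ^ i) ` {..<n}"
  have S: "?S \<subseteq> D" using d by auto
  moreover have "d \<in> ?S" using n by (intro image_eqI[of _ _ 0]) auto
  ultimately have star: "d.star_ideal (dspan D ?S)" using d by (intro d.star_idealI) auto
  have "x * y \<in> dspan D ?S" if y: "y \<in> ?S" for y
  proof -
    obtain i where i: "i < n" "y = d * x ^ i" using y by blast
    show ?thesis
    proof (cases "Suc i < n")
      case True
      have "x * y = d * x ^ Suc i" using i by (simp add: mult.left_commute)
      then have "x * y \<in> ?S" using True by blast
      then show ?thesis by (rule subsetD[OF subset_dspan])
    next
      case False
      then have "x * y = d * x ^ n" using i by (metis Suc_lessI mult.left_commute power_Suc)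
      also have "x ^ n = (\<Sum>i<n. - c i * x ^ i)" using eq by (simp add: sum_negf add_eq_0_iff2)
      also have "d * \<dots> = (\<Sum>i<n. - c i * (d * x ^ i))" by (simp add: sum_distrib_left mult.left_commute)
      also have "\<dots> \<in> dspan D ?S"
        using c by (intro d.sum_cl dspan.scale uminus_mem) auto
      finally show ?thesis .
    qed
  qed
  then have "{x} * ?S \<subseteq> dspan D ?S" by (auto simp: set_times_def)
  then have "dspan D ({x} * ?S) \<subseteq> dspan D ?S" by (simp only: d.cl_subset_iff)
  then have "{x} * dspan D ?S \<subseteq> dspan D ?S" using d.singleton_times_cl by blast
  then show "x \<in> D" using d.multiplier_of_invertible inv star by blast
qed

text \<open>Let P \<subseteq> M and Q = P M^-1, so that Q M = P. If some m \<in> M is not in P, then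
  q m \<in> P forces q \<in> P for all q \<in> Q. So Q = P, and cancelling P in P M = P gives M =
  D.\<close>

lemma d_star_maximal_prime_subset:
  assumes inv: "\<And>I. d.star_ideal I \<Longrightarrow> d.star_invertible I"
    and P: "primeideal P (ring_on D)" "P \<noteq> {0}"
  shows "d.star_maximal P"
proof -
  note P' = P(1)[unfolded primeideal_iff]
  have star: "d.star_ideal P" "P \<noteq> D" using P' P(2) by (auto simp: d.star_ideal_def)
  then obtain M where M: "d.star_maximal M" "P \<subseteq> M" using d.subset_star_maximal by blast
  note M' = d.star_maximalD[OF M(1)]
  let ?Q = "dspan D (P * frac_inverse D M)"
  have Q: "d.star_ideal ?Q" using d.star_ideal_times_frac_inverse star M M' by blast
  have QM: "dspan D (?Q * M) = P"
    using d.cl_times_invertible_cancel[OF inv[OF M'(1)]] star d.star_idealD(2) by blast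
  show ?thesis
  proof (rule ccontr)
    assume "\<not> d.star_maximal P"
    then have "P \<noteq> M" using M(1) by blast
    then obtain m where m: "m \<in> M" "m \<notin> P" using M(2) by blast
    have "q \<in> P" if q: "q \<in> ?Q" for q
    proof -
      have "q * m \<in> P" using q m(1) QM subset_dspan[of "?Q * M"] by blast
      then show ?thesis using P' m M'(4) q d.star_idealD(1)[OF Q] by blast
    qed
    then have "?Q = P" using d.subset_cl_times_frac_inverse[OF star(1) M'(1)] by blast
    then have "M = D" using d.star_invertible_absorb[OF star(1) inv M'(1)] QM star by simp
    then show False using M' by blast
  qed
qed

text \<open>For a nonzero y \<in> I all x^n y stay in I, so they generate a finitely generated
  ideal, which is already spanned by the first n of them. Expressing x^n y through these and
  dividing by y gives an integral equation for x.\<close>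

lemma noetherian_multiplier:
  assumes noeth: "noetherian_domain (ring_on D)" and closed: "integrally_closed_domain D"
    and I: "d.star_ideal I" and x: "{x} * I \<subseteq> I"
  shows "x \<in> D"
proof -
  obtain y where y: "y \<in> I" "y \<noteq> 0" using d.star_idealD(5)[OF I] by blast
  have mem: "x ^ n * y \<in> I" for n
  proof (induction n)
    case (Suc n)
    then have "x * (x ^ n * y) \<in> {x} * I" by auto
    then show ?case using x by (auto simp: mult.assoc)
  qed (use y in simp)
  let ?U = "range (\<lambda>n. x ^ n * y)"
  have "y \<in> ?U" by (intro range_eqI[of _ _ 0]) simp
  then have "d.star_ideal (dspan D ?U)"
    using mem y d.star_idealD(1)[OF I] by (intro d.star_idealI[of _ y]) auto
  then obtain F where F: "finite F" "F \<subseteq> dspan D ?U" "dspan D F = dspan D ?U"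
    using noeth unfolding noetherian_domain_iff by blast
  have "\<exists>n. F \<subseteq> dspan D ((\<lambda>i. x ^ i * y) ` {..<n})" using F(1,2)
  proof (induction F)
    case (insert z F)
    then obtain n where n: "F \<subseteq> dspan D ((\<lambda>i. x ^ i * y) ` {..<n})" by blast
    obtain G where G: "finite G" "G \<subseteq> ?U" "z \<in> dspan D G" using insert d.cl_finite[of z ?U] by blast
    obtain A where A: "finite A" "G = (\<lambda>i. x ^ i * y) ` A" using finite_subset_image[OF G(1,2)] by blast
    obtain m where m: "A \<subseteq> {..<m}" using finite_nat_iff_bounded A(1) by blast
    let ?V = "\<lambda>n. dspan D ((\<lambda>i. x ^ i * y) ` {..<n})"
    have "?V n \<subseteq> ?V (max n m)" "dspan D G \<subseteq> ?V (max n m)"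
      using m unfolding A(2) by (intro dspan_mono image_mono; force)+
    then have "insert z F \<subseteq> ?V (max n m)" using n G(3) by blast
    then show ?case by blast
  qed simp
  then obtain n where n: "F \<subseteq> dspan D ((\<lambda>i. x ^ i * y) ` {..<n})" by blast
  let ?S = "(\<lambda>i. x ^ i * y) ` {..<n}"
  have "dspan D ?U \<subseteq> dspan D ?S" using n F(3) by (metis d.cl_subset_iff)
  then have U: "x ^ k * y \<in> dspan D ?S" for k using subset_dspan by blast
  have S: "\<exists>c. (\<forall>i<n. c i \<in> D) \<and> z = (\<Sum>i<n. c i * (x ^ i * y))" if "z \<in> dspan D ?S" for z
    using that
  proof induction
    case zero
    then show ?case by (intro exI[of _ "\<lambda>_. 0"]) auto
  next
    case (scale d z)
    then obtain j where j: "j < n" "z = x ^ j * y" by blast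
    have "(\<Sum>i<n. (if i = j then d else 0) * (x ^ i * y)) = (\<Sum>i<n. if i = j then d * (x ^ i * y) else 0)"
      by (intro sum.cong) auto
    then show ?case using scale(1) j by (intro exI[of _ "\<lambda>i. if i = j then d else 0"]) auto
  next
    case (add z w)
    then obtain c e where "\<forall>i<n. c i \<in> D" "z = (\<Sum>i<n. c i * (x ^ i * y))"
      "\<forall>i<n. e i \<in> D" "w = (\<Sum>i<n. e i * (x ^ i * y))" by blast
    then show ?case by (intro exI[of _ "\<lambda>i. c i + e i"]) (auto simp: sum.distrib distrib_right)
  qed
  \<comment> \<open>Integral closedness needs an equation of positive degree; n = 0 would put y into
    the zero module.\<close>
  have "n \<noteq> 0"
  proof
    assume "n = 0"
    then have "y = 0" using S[OF U[of 0]] by simp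
    then show False using y by simp
  qed
  obtain c where c: "\<forall>i<n. c i \<in> D" "x ^ n * y = (\<Sum>i<n. c i * (x ^ i * y))" using S U by blast
  then have "x ^ n * y = (\<Sum>i<n. c i * x ^ i) * y" by (simp add: sum_distrib_right mult.assoc)
  then have "x ^ n + (\<Sum>i<n. - c i * x ^ i) = 0" using y by (simp add: sum_negf)
  moreover have "\<forall>i<n. - c i \<in> D" using c(1) by auto
  ultimately show "x \<in> D"
    using closed[unfolded integrally_closed_domain_def, rule_format, of n "\<lambda>i. - c i" x] \<open>n \<noteq> 0\<close>
    by simp
qed

text \<open>
  Among the ideals \<open>(a D : b)\<close> inside \<open>M\<close> a maximal one is prime, so it is \<open>M\<close> in dimension one;
  then \<open>b / a\<close> is in \<open>M\<^sup>-\<^sup>1\<close> but not in \<open>D\<close>.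
\<close>

lemma frac_inverse_not_subset:
  assumes noeth: "noetherian_domain (ring_on D)"
    and dim: "\<And>P. primeideal P (ring_on D) \<Longrightarrow> P \<noteq> {0} \<Longrightarrow> d.star_maximal P"
    and M: "d.star_maximal M"
  shows "\<not> frac_inverse D M \<subseteq> D"
proof -
  note M' = d.star_maximalD[OF M]
  obtain a where a: "a \<in> M" "a \<noteq> 0" using d.star_idealD(5)[OF M'(1)] by blast
  define A where "A = {a} * D"
  define J where "J b = {d \<in> D. d * b \<in> A}" for b
  have A: "dspan D A = A" using dspan_singleton[of a] d.cl_idem[of "{a}"] by (simp add: A_def)
  have "A \<subseteq> M" using a d.star_ideal_scale[OF M'(1)] by (auto simp: A_def set_times_def mult.commute)
  have A_scale: "d * x \<in> A" if "d \<in> D" "x \<in> A" for d x using d.D_times_subset[OF A] that by blast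
  have A_add: "x + y \<in> A" if "x \<in> A" "y \<in> A" for x y using dspan.add[of x D A y] that A by simp
  have "0 \<in> A" using A dspan.zero by metis
  have "a \<in> A" unfolding A_def using set_times_intro[of a "{a}" 1 D] by auto
  have star: "d.star_ideal (J b)" if b: "b \<in> D" for b
  proof -
    have "a \<in> J b" using A_scale[OF b \<open>a \<in> A\<close>] a M' by (auto simp: J_def mult.commute)
    moreover have "dspan D (J b) \<subseteq> J b"
      using A_scale A_add \<open>0 \<in> A\<close> by (intro dspan_least) (auto simp: J_def distrib_right mult.assoc)
    ultimately show ?thesis
      using a subset_dspan[of "J b"] by (auto simp: d.star_ideal_def J_def)
  qed
  define C where "C = {J b | b. b \<in> D \<and> J b \<subseteq> M}"
  have "J 1 \<subseteq> M" using \<open>A \<subseteq> M\<close> by (auto simp: J_def)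
  then have "J 1 \<in> C" unfolding C_def by blast
  have "\<exists>I\<in>C. \<forall>I'\<in>C. \<not> I \<subset> I'"
  proof (rule ccontr)
    \<comment> \<open>A maximal member of C comes from Noetherian induction on the statement that an
      ideal is not in C, applied to \<open>J 1\<close>.\<close>
    assume no_max: "\<not> (\<exists>I\<in>C. \<forall>I'\<in>C. \<not> I \<subset> I')"
    have fin: "\<exists>F. finite F \<and> F \<subseteq> I \<and> dspan D F = I" if "d.star_ideal I" for I
      using noeth that unfolding noetherian_domain_iff by blast
    have step: "I \<notin> C" if IH: "\<And>I'. d.star_ideal I' \<Longrightarrow> I \<subset> I' \<Longrightarrow> I' \<notin> C" for I
    proof
      assume "I \<in> C"
      then obtain I' where "I' \<in> C" "I \<subset> I'" using no_max by blast
      moreover have "d.star_ideal I'" using \<open>I' \<in> C\<close> star unfolding C_def by blast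
      ultimately show False using IH by blast
    qed
    have "J 1 \<notin> C" using fin step star[OF one_mem] by (rule d.star_induct[of "\<lambda>I. I \<notin> C"])
    then show False using \<open>J 1 \<in> C\<close> by blast
  qed
  then obtain I where I: "I \<in> C" "\<And>I'. I' \<in> C \<Longrightarrow> \<not> I \<subset> I'" by blast
  then obtain b where b: "b \<in> D" "J b \<subseteq> M" "I = J b" unfolding C_def by blast
  have max: "\<not> J b \<subset> J e" if "e \<in> D" "J e \<subseteq> M" for e
    using I(2)[of "J e"] that b(3) unfolding C_def by blast
  have J_mono: "J b \<subseteq> J (s * b)" if "s \<in> D" for s
    using A_scale[OF that] by (auto simp: J_def mult.left_commute[of _ s b])
  have "x \<in> J b" if xy: "x \<in> D" "y \<in> D" "x * y \<in> J b" "y \<notin> J b" for x y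
  \<comment> \<open>If \<open>J (y * b)\<close> lies in M, it equals \<open>J b\<close> by
    maximality, and x belongs to it. Otherwise some s outside M has s y b \<in> A; then
    \<open>J (s * b)\<close> lies in M since M is prime, so it equals \<open>J b\<close>, but it
    contains y, contrary to y \<notin> \<open>J b\<close>.\<close>
  proof (cases "J (y * b) \<subseteq> M")
    case True
    then have "J (y * b) = J b" using max[of "y * b"] J_mono[of y] xy b by auto
    then show ?thesis using xy by (auto simp: J_def mult.assoc)
  next
    case False
    then obtain s where s: "s \<in> D" "s * (y * b) \<in> A" "s \<notin> M" by (auto simp: J_def)
    have "J (s * b) \<subseteq> M"
    proof
      fix z assume z: "z \<in> J (s * b)"
      then have "z * s \<in> J b" using s by (auto simp: J_def mult.assoc)
      then have "s * z \<in> M" using b by (auto simp: mult.commute)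
      then show "z \<in> M" using d.star_maximal_prime[OF M s(1)] s z by (auto simp: J_def)
    qed
    then have "J (s * b) = J b" using max[of "s * b"] J_mono[of s] s b by auto
    moreover have "y \<in> J (s * b)" using xy s by (auto simp: J_def mult_ac)
    ultimately show ?thesis using xy by simp
  qed
  then have "primeideal (J b) (ring_on D)"
    using b M' star[OF b(1)] d.star_idealD(1,2)[OF star[OF b(1)]] unfolding primeideal_iff by blast
  then have "d.star_maximal (J b)" using dim d.star_idealD(4)[OF star[OF b(1)]] by blast
  then have "J b = M" using d.star_maximalD(5)[of "J b" M] b M' by auto
  have "b / a * y \<in> D" if "y \<in> M" for y
  proof -
    have "y * b \<in> A" using that \<open>J b = M\<close> by (auto simp: J_def)
    then show ?thesis using a by (auto simp: A_def set_times_def field_simps)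
  qed
  then have "b / a \<in> frac_inverse D M" by (auto simp: frac_inverse_def)
  moreover have "b / a \<notin> D"
  proof
    assume "b / a \<in> D"
    then have "1 * b \<in> A" unfolding A_def using a by (intro set_times_memI[of a _ "b / a"]) auto
    then have "1 \<in> J b" by (auto simp: J_def)
    then show False using b M' by blast
  qed
  ultimately show ?thesis by blast
qed

text \<open>From the classical definition, induct on I with Q = I M^-1, where M is not yet known to
  be invertible. If Q = I, every element of M^-1 is a multiplier of I and so lies in D,
  contradicting \<open>frac_inverse_not_subset\<close>. Otherwise Q is invertible, and so is I, as
  M^-1 Q^-1 \<subseteq> I^-1.\<close>

theorem dedekind_domain_iff:
  "dedekind_domain D \<longleftrightarrow> (\<forall>I. d.star_ideal I \<longrightarrow> d.star_invertible I)"
proof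
  assume "dedekind_domain D"
  then have noeth: "noetherian_domain (ring_on D)" and closed: "integrally_closed_domain D"
    and dim: "\<And>P. primeideal P (ring_on D) \<Longrightarrow> P \<noteq> {0} \<Longrightarrow> d.star_maximal P"
    by (auto simp: dedekind_domain_def maximalideal_iff)
  have fin: "\<exists>F. finite F \<and> F \<subseteq> I \<and> dspan D F = I" if "d.star_ideal I" for I
    using noeth that unfolding noetherian_domain_iff by blast
  have step: "d.star_invertible I"
    if I: "d.star_ideal I" and IH: "\<And>J. d.star_ideal J \<Longrightarrow> I \<subset> J \<Longrightarrow> d.star_invertible J" for I
  proof (cases "I = D")
    case False
    then obtain M where M: "d.star_maximal M" "I \<subseteq> M" using d.subset_star_maximal I by blast
    note M' = d.star_maximalD[OF M(1)]
    let ?Q = "dspan D (I * frac_inverse D M)"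
    have Q: "d.star_ideal ?Q" using d.star_ideal_times_frac_inverse I M M' by blast
    have "?Q \<noteq> I"
    proof
      assume Q: "?Q = I"
      have "{x} * I \<subseteq> I" if x: "x \<in> frac_inverse D M" for x
      proof -
        have "I * {x} \<subseteq> I * frac_inverse D M" using x by (intro set_times_mono2) auto
        then have "I * {x} \<subseteq> I" using Q subset_dspan[of "I * frac_inverse D M"] by blast
        then show ?thesis by (simp only: mult.commute)
      qed
      then have "frac_inverse D M \<subseteq> D" using noetherian_multiplier[OF noeth closed I] by blast
      then show False using frac_inverse_not_subset[OF noeth dim M(1)] by blast
    qed
    then have "d.star_invertible ?Q" using IH Q d.subset_cl_times_frac_inverse[OF I M'(1)] by blast
    then have "1 \<in> dspan D (?Q * frac_inverse D ?Q)" by (simp add: d.star_invertible_def)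
    also have "\<dots> = dspan D (I * (frac_inverse D M * frac_inverse D ?Q))"
      by (simp add: d.cl_times_cl_left mult.assoc)
    also have "\<dots> \<subseteq> dspan D (I * frac_inverse D I)"
    proof (intro dspan_mono set_times_mono2 order_refl subsetI)
      fix z assume "z \<in> frac_inverse D M * frac_inverse D ?Q"
      then obtain x y where xy: "x \<in> frac_inverse D M" "y \<in> frac_inverse D ?Q" "z = x * y"
        by (rule set_times_memE)
      have "z * i \<in> D" if "i \<in> I" for i
      proof -
        have "i * x \<in> I * frac_inverse D M" using that xy by blast
        then have "i * x \<in> ?Q" using subset_dspan by blast
        then have "y * (i * x) \<in> D" using xy(2) frac_inverse_memD by blast
        then show ?thesis using xy(3) by (simp add: mult_ac)
      qed
      then show "z \<in> frac_inverse D I" by (simp add: frac_inverse_def)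
    qed
    finally show ?thesis by (simp add: d.star_invertible_def)
  qed (use d.star_invertible_D in simp)
  show "\<forall>I. d.star_ideal I \<longrightarrow> d.star_invertible I"
    using d.star_induct[of d.star_invertible, OF fin step] by blast
next
  assume "\<forall>I. d.star_ideal I \<longrightarrow> d.star_invertible I"
  then have inv: "d.star_invertible I" if "d.star_ideal I" for I using that by blast
  have "noetherian_domain (ring_on D)"
    unfolding noetherian_domain_iff using d.star_invertible_finite inv d.star_idealD(2) by metis
  moreover have "integrally_closed_domain D" by (rule invertible_imp_integrally_closed[OF inv])
  ultimately show "dedekind_domain D"
    unfolding dedekind_domain_def maximalideal_iff using d_star_maximal_prime_subset[OF inv] by blast
qed

end

section \<open>Localizations\<close>

lemma localizationI: "a \<in> D \<Longrightarrow> s \<in> D \<Longrightarrow> s \<notin> P \<Longrightarrow> a / s \<in> localization D P"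
  by (auto simp: localization_def)

lemma localizationE:
  assumes "x \<in> localization D P"
  obtains a s where "a \<in> D" "s \<in> D" "s \<notin> P" "x = a / s"
  using assms by (auto simp: localization_def)

context domain_in_field
begin

lemma prime_idealD:
  assumes "primeideal P (ring_on D)"
  shows "P \<subseteq> D" "dspan D P = P" "1 \<notin> P" "0 \<in> P"
    and "\<And>a b. a \<in> D \<Longrightarrow> b \<in> D \<Longrightarrow> a \<notin> P \<Longrightarrow> b \<notin> P \<Longrightarrow> a * b \<notin> P"
    and "\<And>a b. a \<in> D \<Longrightarrow> b \<in> P \<Longrightarrow> a * b \<in> P"
proof -
  have P: "P \<subseteq> D" "dspan D P = P" "1 \<notin> P"
    "\<forall>a\<in>D. \<forall>b\<in>D. a * b \<in> P \<longrightarrow> a \<in> P \<or> b \<in> P"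
    using assms unfolding primeideal_iff by blast+
  then show "P \<subseteq> D" "dspan D P = P" "1 \<notin> P"
    and "\<And>a b. a \<in> D \<Longrightarrow> b \<in> D \<Longrightarrow> a \<notin> P \<Longrightarrow> b \<notin> P \<Longrightarrow> a * b \<notin> P" by blast+
  show "0 \<in> P" using P(2) dspan.zero by metis
  show "a * b \<in> P" if "a \<in> D" "b \<in> P" for a b using that P(2) dspan_scale by metis
qed

lemma prime_power_notin:
  assumes "primeideal P (ring_on D)" "a \<in> D" "a \<notin> P"
  shows "a ^ n \<notin> P"
  by (induction n) (use assms prime_idealD(3)[OF assms(1)] prime_idealD(5)[OF assms(1)] in \<open>auto simp: power_mem\<close>)

lemma prime_prod_notin:
  assumes "primeideal P (ring_on D)" "\<And>i. i \<in> A \<Longrightarrow> f i \<in> D - P"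
  shows "prod f A \<in> D - P"
  using assms(2) by (induction A rule: infinite_finite_induct) (use prime_idealD[OF assms(1)] in auto)

lemma subset_localization: "primeideal P (ring_on D) \<Longrightarrow> D \<subseteq> localization D P"
  using localizationI[of _ D 1 P] prime_idealD(3) by fastforce

lemma localization_inverse:
  "s \<in> D \<Longrightarrow> s \<notin> P \<Longrightarrow> inverse s \<in> localization D P"
  using localizationI[of 1 D s P] by (simp add: inverse_eq_divide)

lemma inverse_notin_localization:
  assumes P: "primeideal P (ring_on D)" and p: "p \<in> P" "p \<noteq> 0"
  shows "inverse p \<notin> localization D P"
proof
  assume "inverse p \<in> localization D P"
  then obtain a s where as: "a \<in> D" "s \<in> D" "s \<notin> P" "inverse p = a / s" by (rule localizationE)
  then have "s \<noteq> 0" using prime_idealD(4)[OF P(1)] by auto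
  then have "s = a * p" using as p by (simp add: field_simps)
  then show False using as p prime_idealD(6)[OF P(1)] by blast
qed

lemma domain_in_field_localization:
  assumes P: "primeideal P (ring_on D)" "P \<noteq> {0}"
  shows "domain_in_field (localization D P)"
proof
  note P' = prime_idealD[OF P(1)]
  note DV = subset_localization[OF P(1)]
  show "0 \<in> localization D P" "1 \<in> localization D P" using DV by auto
  fix x y assume "x \<in> localization D P" "y \<in> localization D P"
  then obtain a b s t where ab: "a \<in> D" "s \<in> D" "s \<notin> P" "x = a / s" "b \<in> D" "t \<in> D" "t \<notin> P" "y = b / t"
    by (metis localizationE)
  then have "s \<noteq> 0" "t \<noteq> 0" using P' by auto
  then have "x + y = (a * t + b * s) / (s * t)" "x * y = (a * b) / (s * t)"
    using ab by (auto simp: field_simps)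
  moreover have "s * t \<notin> P" using ab P' by blast
  ultimately show "x + y \<in> localization D P" "x * y \<in> localization D P"
    using ab by (metis add_mem localizationI mult_mem)+
next
  fix x assume "x \<in> localization D P"
  then obtain a s where "a \<in> D" "s \<in> D" "s \<notin> P" "x = a / s" by (rule localizationE)
  then show "- x \<in> localization D P" using localizationI[of "- a" D s P] by auto
next
  show "has_quotient_field (localization D P)"
    using quotient_field subset_localization[OF P(1)] unfolding has_quotient_field_def by blast
  obtain p where p: "p \<in> P" "p \<noteq> 0" using P prime_idealD(4) by blast
  then show "localization D P \<noteq> UNIV" using inverse_notin_localization[OF P(1)] by blast
qed

lemma localization_common_denominator:
  assumes "primeideal P (ring_on D)" "finite F" "F \<subseteq> localization D P"
  shows "\<exists>s\<in>D - P. \<forall>z\<in>F. s * z \<in> D"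
  using assms(2,3)
proof (induction F)
  case empty
  then show ?case using prime_idealD(3)[OF assms(1)] by auto
next
  case (insert y F)
  then obtain s where s: "s \<in> D" "s \<notin> P" "\<forall>z\<in>F. s * z \<in> D" by blast
  have "y \<in> localization D P" using insert.prems by blast
  then obtain a t where at: "a \<in> D" "t \<in> D" "t \<notin> P" "y = a / t" by (rule localizationE)
  then have "t \<noteq> 0" using prime_idealD(4)[OF assms(1)] by auto
  have "(s * t) * z \<in> D" if "z \<in> F" for z
    using mult_mem[OF at(2)] s(3) that by (metis mult.assoc mult.left_commute)
  moreover have "(s * t) * y \<in> D" using at s \<open>t \<noteq> 0\<close> by auto
  moreover have "s * t \<in> D - P" using at s prime_idealD(5)[OF assms(1)] by blast
  ultimately show ?case by blast
qed

lemma localization_prime_ideal: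
  assumes P: "primeideal P (ring_on D)" "P \<noteq> {0}" and N: "primeideal N (ring_on D)" and "P \<subseteq> N"
  defines "Q \<equiv> {p / s | p s. p \<in> P \<and> s \<in> D - N}"
  shows "primeideal Q (ring_on (localization D N))" "P \<subseteq> Q" "Q \<inter> D = P"
proof -
  note P' = prime_idealD[OF P(1)] and N' = prime_idealD[OF N]
  have "N \<noteq> {0}" using P P'(4) \<open>P \<subseteq> N\<close> by blast
  interpret V: domain_in_field "localization D N"
    using domain_in_field_localization N \<open>N \<noteq> {0}\<close> by blast
  have nz: "s \<noteq> 0" if "s \<notin> N" for s using that N'(4) by auto
  show "P \<subseteq> Q" using N'(3) one_mem by (force simp: Q_def)
  \<comment> \<open>Membership in Q does not depend on how a fraction is written: denominators lie
    outside N, hence outside the prime P, and can be cancelled.\<close>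
  have num: "a \<in> P" if as: "a / s \<in> Q" "a \<in> D" "s \<in> D - N" for a s
  proof -
    obtain p t where pt: "p \<in> P" "t \<in> D - N" "a / s = p / t" using as(1) unfolding Q_def by blast
    then have "t * a = s * p" using as(3) nz[of s] nz[of t] by (simp add: field_simps)
    then have "t * a \<in> P" using pt as P'(6) by auto
    then show "a \<in> P" using P'(5)[of t a] pt as \<open>P \<subseteq> N\<close> by blast
  qed
  have "1 \<notin> Q" using num[of 1 1] P'(3) N'(3) by auto
  moreover have "Q \<subseteq> localization D N" using P'(1) by (auto simp: Q_def localization_def)
  moreover have "dspan (localization D N) Q \<subseteq> Q"
  proof (rule V.dspan_least)
    show "0 \<in> Q" using \<open>P \<subseteq> Q\<close> P'(4) by blast
    fix x y assume "x \<in> Q" "y \<in> Q"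
    then obtain p q s t where pq: "p \<in> P" "s \<in> D - N" "x = p / s" "q \<in> P" "t \<in> D - N" "y = q / t"
      unfolding Q_def by blast
    then have "x + y = (t * p + s * q) / (s * t)" using nz[of s] nz[of t] by (simp add: field_simps)
    moreover have "s * t \<in> D - N" using pq N'(5) by auto
    moreover have "t * p + s * q \<in> P" using pq P'(2,6) dspan.add[of _ D P] by auto
    ultimately show "x + y \<in> Q" unfolding Q_def by blast
  next
    fix d x assume "d \<in> localization D N" "x \<in> Q"
    then obtain a s p t where pq: "a \<in> D" "s \<in> D - N" "d = a / s" "p \<in> P" "t \<in> D - N" "x = p / t"
      unfolding Q_def localization_def by blast
    then have "d * x = (a * p) / (s * t)" by simp
    moreover have "s * t \<in> D - N" "a * p \<in> P" using pq N'(5) P'(6) by auto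
    ultimately show "d * x \<in> Q" unfolding Q_def by blast
  qed auto
  moreover have "x \<in> Q \<or> y \<in> Q"
    if xy: "x \<in> localization D N" "y \<in> localization D N" "x * y \<in> Q" for x y
  proof -
    obtain a s b t where ab: "a \<in> D" "s \<in> D - N" "x = a / s" "b \<in> D" "t \<in> D - N" "y = b / t"
      using xy(1,2) unfolding localization_def by blast
    then have "a * b \<in> P" using num[of "a * b" "s * t"] xy(3) N'(5) by auto
    then have "a \<in> P \<or> b \<in> P" using ab P'(5) by blast
    then show ?thesis using ab unfolding Q_def by blast
  qed
  ultimately show "primeideal Q (ring_on (localization D N))"
    unfolding V.primeideal_iff using V.subset_dspan by blast
  have "Q \<inter> D \<subseteq> P" using num[of _ 1] N'(3) by auto
  then show "Q \<inter> D = P" using \<open>P \<subseteq> Q\<close> P'(1) by blast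
qed

section \<open>Discrete valuation rings\<close>

text \<open>The exponent k acts as the value of x. An ideal is generated by m^n for the least n with
  m^n in it, and mD is the only maximal ideal.\<close>

lemma discrete_valuation_ringI:
  assumes m: "m \<in> D" "m \<noteq> 0" "inverse m \<notin> D"
    and factor: "\<And>x. x \<in> D \<Longrightarrow> x \<noteq> 0 \<Longrightarrow> \<exists>k u. x = m ^ k * u \<and> u \<in> D \<and> inverse u \<in> D"
  shows "discrete_valuation_ring D"
proof -
  have ideal: "\<exists>n. I = {m ^ n} * D" if I: "d.star_ideal I" for I
  proof -
    have power: "\<exists>k u. x = m ^ k * u \<and> u \<in> D \<and> m ^ k \<in> I" if x: "x \<in> I" "x \<noteq> 0" for x
    proof -
      obtain k u where u: "x = m ^ k * u" "u \<in> D" "inverse u \<in> D"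
        using factor x d.star_idealD(1)[OF I] by blast
      have "inverse u * x \<in> I" using d.star_ideal_scale[OF I] u x by blast
      moreover have "inverse u * x = m ^ k" using u(1) x(2) by auto
      ultimately show ?thesis using u by metis
    qed
    define n where "n = (LEAST n. m ^ n \<in> I)"
    have "\<exists>n. m ^ n \<in> I" using power d.star_idealD(5)[OF I] by blast
    then have n: "m ^ n \<in> I" unfolding n_def by (rule LeastI_ex)
    have "x \<in> {m ^ n} * D" if x: "x \<in> I" for x
    proof (cases "x = 0")
      case False
      then obtain k u where u: "x = m ^ k * u" "u \<in> D" "m ^ k \<in> I" using power x by blast
      then have "n \<le> k" unfolding n_def by (intro Least_le)
      then have "m ^ k = m ^ n * m ^ (k - n)" by (simp flip: power_add)
      then have "x = m ^ n * (m ^ (k - n) * u)" using u(1) by (simp only: mult.assoc)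
      then show ?thesis using u(2) m(1) by (intro set_times_memI[of "m ^ n" _ "m ^ (k - n) * u"]) auto
    qed (auto intro: set_times_memI[of "m ^ n"])
    moreover have "{m ^ n} * D \<subseteq> I"
      using n d.star_ideal_scale[OF I] by (auto simp: set_times_def mult.commute)
    ultimately show ?thesis by blast
  qed
  have mstar: "d.star_ideal ({m} * D)" using d.star_idealI[of "{m}" m] m by (simp add: dspan_singleton)
  have "1 \<notin> {m} * D" using m inverse_unique by (metis mem_singleton_times)
  then have mD: "{m} * D \<noteq> D" by auto
  have "N = {m} * D" if N: "d.star_maximal N" for N
  proof -
    obtain n where n: "N = {m ^ n} * D" using ideal d.star_maximalD(1)[OF N] by blast
    have "n \<noteq> 0" using n d.star_maximalD(2)[OF N] by (cases n) auto
    then obtain k where "n = Suc k" using not0_implies_Suc by blast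
    then have "N \<subseteq> {m} * D" using m unfolding n by (auto simp: set_times_def mult.assoc)
    then show ?thesis using d.star_maximalD(5)[OF N mstar mD] by simp
  qed
  moreover obtain N where "d.star_maximal N" using d.subset_star_maximal[OF mstar mD] by blast
  ultimately have "\<exists>!N. maximalideal N (ring_on D)" unfolding maximalideal_iff by blast
  moreover have "principal_domain (ring_on D)"
    unfolding principal_domain_iff using ideal m by blast
  ultimately show ?thesis using not_field by (simp add: discrete_valuation_ring_def)
qed

text \<open>A generator of the extension of P to D_P has the form p/s with s a unit of D_P, so p
  \<in> P is a generator too. If j \<noteq> 0 generated the intersection of all p^n D_P, then j/p
  would lie in it and 1/p in D_P. So a nonzero x lies in a last p^k D_P, and its cofactor is a
  unit.\<close>

lemma discrete_valuation_ring_uniformizer: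
  assumes P: "primeideal P (ring_on D)" "P \<noteq> {0}"
    and dvr: "discrete_valuation_ring (localization D P)"
  obtains p where "p \<in> P" "p \<noteq> 0" "P \<subseteq> {p} * localization D P"
    "\<And>x. x \<in> localization D P \<Longrightarrow> x \<noteq> 0 \<Longrightarrow>
       \<exists>k u. x = p ^ k * u \<and> u \<in> localization D P \<and> inverse u \<in> localization D P"
proof -
  let ?V = "localization D P"
  note P' = prime_idealD[OF P(1)]
  interpret V: domain_in_field ?V using domain_in_field_localization P by blast
  have principal: "\<exists>a\<in>?V. I = {a} * ?V" if "V.d.star_ideal I" for I
    using dvr that V.principal_domain_iff by (simp add: discrete_valuation_ring_def)
  define Q where "Q = {p / s | p s. p \<in> P \<and> s \<in> D - P}"
  have Q: "primeideal Q (ring_on ?V)" "P \<subseteq> Q"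
    using localization_prime_ideal[OF P P(1)] by (auto simp: Q_def)
  then have "V.d.star_ideal Q"
    using V.prime_idealD(1,2)[OF Q(1)] P P'(4) by (auto simp: V.d.star_ideal_def)
  then obtain q where q: "q \<in> ?V" "Q = {q} * ?V" using principal by blast
  have "q * 1 \<in> Q" unfolding q(2) by (rule set_times_intro) auto
  then obtain p s where p: "p \<in> P" "s \<in> D" "s \<notin> P" "q = p / s" unfolding Q_def by auto
  have s: "s \<noteq> 0" "inverse s \<in> ?V" using p P'(4) localization_inverse by auto
  have Qp: "Q \<subseteq> {p} * ?V"
  proof
    fix x assume "x \<in> Q"
    then obtain v where "v \<in> ?V" "x = q * v" unfolding q(2) mem_singleton_times by blast
    then show "x \<in> {p} * ?V"
      using p s by (intro set_times_memI[of p _ "inverse s * v"]) (auto simp: divide_inverse)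
  qed
  have "p \<noteq> 0"
  proof
    assume "p = 0"
    then have "P \<subseteq> {0}" using Q(2) Qp by (auto simp: set_times_def)
    then show False using P P'(4) by blast
  qed
  note inv_p = inverse_notin_localization[OF P(1) p(1) \<open>p \<noteq> 0\<close>]
  have "p \<in> ?V" using p P'(1) subset_localization[OF P(1)] by blast
  define J where "J = (\<Inter>n. {p ^ n} * ?V)"
  have J0: "J = {0}"
  proof (rule ccontr)
    assume "J \<noteq> {0}"
    have star: "V.d.star_ideal ({p ^ n} * ?V)" for n
      using V.d.star_idealI[of "{p ^ n}" "p ^ n"] \<open>p \<in> ?V\<close> \<open>p \<noteq> 0\<close> by (auto simp: V.d.cl_singleton)
    have "0 \<in> J" using V.d.star_idealD(3)[OF star] by (auto simp: J_def)
    have "V.d.star_ideal J"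
      unfolding V.d.star_ideal_def
    proof (intro conjI \<open>J \<noteq> {0}\<close>)
      have "J \<subseteq> {p ^ 0} * ?V" unfolding J_def by blast
      then show "J \<subseteq> ?V" by simp
      have "dspan ?V J \<subseteq> {p ^ n} * ?V" for n
        using V.d.star_idealD(2)[OF star] by (intro V.d.cl_subsetI) (auto simp: J_def)
      then show "dspan ?V J = J" using V.subset_dspan[of J] unfolding J_def by blast
    qed
    then obtain j where j: "j \<in> ?V" "J = {j} * ?V" using principal by blast
    have "j * 1 \<in> J" unfolding j(2) by (rule set_times_intro) auto
    have "j \<noteq> 0" using j(2) \<open>J \<noteq> {0}\<close> \<open>0 \<in> J\<close> by (auto simp: set_times_def)
    have "j / p \<in> {p ^ n} * ?V" for n
    proof -
      have "j \<in> {p ^ Suc n} * ?V" using \<open>j * 1 \<in> J\<close> by (simp add: J_def del: power_Suc)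
      then obtain v where "v \<in> ?V" "j = p ^ Suc n * v" unfolding mem_singleton_times by blast
      then show ?thesis using \<open>p \<noteq> 0\<close> by (intro set_times_memI[of "p ^ n" _ v]) auto
    qed
    then have "j / p \<in> J" by (simp add: J_def)
    then obtain v where "v \<in> ?V" "j / p = j * v" unfolding j(2) mem_singleton_times by blast
    then have "inverse p \<in> ?V" using \<open>j \<noteq> 0\<close> by (simp add: divide_inverse)
    then show False using inv_p by blast
  qed
  have "\<exists>k u. x = p ^ k * u \<and> u \<in> ?V \<and> inverse u \<in> ?V" if x: "x \<in> ?V" "x \<noteq> 0" for x
  proof -
    have "x \<notin> J" using J0 x by simp
    then obtain n where "x \<notin> {p ^ n} * ?V" by (auto simp: J_def)
    then have n: "x \<notin> {p ^ (LEAST n. x \<notin> {p ^ n} * ?V)} * ?V" by (rule LeastI)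
    have "(LEAST n. x \<notin> {p ^ n} * ?V) \<noteq> 0"
    proof
      assume "(LEAST n. x \<notin> {p ^ n} * ?V) = 0"
      then show False using n x by simp
    qed
    then obtain k where k: "(LEAST n. x \<notin> {p ^ n} * ?V) = Suc k" using not0_implies_Suc by blast
    then have "x \<in> {p ^ k} * ?V" using not_less_Least[of k "\<lambda>n. x \<notin> {p ^ n} * ?V"] by auto
    then obtain u where u: "u \<in> ?V" "x = p ^ k * u" unfolding mem_singleton_times by blast
    obtain a t where at: "a \<in> D" "t \<in> D" "t \<notin> P" "u = a / t" using u(1) by (rule localizationE)
    have "a \<notin> P"
    proof
      assume "a \<in> P"
      then have "u \<in> Q" using at by (auto simp: Q_def)
      then have "u \<in> {p} * ?V" using Qp by blast
      then obtain v where "v \<in> ?V" "u = p * v" unfolding mem_singleton_times by blast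
      then have "x \<in> {p ^ Suc k} * ?V" using u(2) by (intro set_times_memI[of "p ^ Suc k" _ v]) auto
      then show False using n k by simp
    qed
    then have "inverse u \<in> ?V" using at localizationI[of t D a P] by simp
    then show ?thesis using u by blast
  qed
  then show ?thesis using that p(1) \<open>p \<noteq> 0\<close> Q(2) Qp by blast
qed

end

section \<open>Krull domains\<close>

context domain_in_field
begin

lemma height_one_primesD:
  assumes "P \<in> height_one_primes D"
  shows "primeideal P (ring_on D)" "P \<noteq> {0}"
    "\<And>Q. primeideal Q (ring_on D) \<Longrightarrow> Q \<noteq> {0} \<Longrightarrow> Q \<subseteq> P \<Longrightarrow> Q = P"
  using assms by (auto simp: height_one_primes_def)

text \<open>Only finitely many height one primes contain a nonzero a \<in> M. If none contained M,
  adding to a one element of M outside each of them would give a finite F \<subseteq> M contained in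
  no height one prime. Then F^-1 lies in all localizations, hence in D, so 1 \<in> F_v \<subseteq>
  M.\<close>

lemma t_star_maximal_height_one:
  assumes krull: "krull_domain D" and M: "t.star_maximal M"
  shows "M \<in> height_one_primes D"
proof -
  let ?H = "height_one_primes D"
  note M' = t.star_maximalD[OF M]
  note M_prime = t_star_maximal_primeideal[OF M]
  obtain a where a: "a \<in> M" "a \<noteq> 0" using t.star_idealD(5)[OF M'(1)] by blast
  let ?A = "{P \<in> ?H. a \<in> P}"
  have fin: "finite ?A" using krull a M'(4) by (auto simp: krull_domain_def)
  have "\<exists>P\<in>?A. M \<subseteq> P"
  proof (rule ccontr)
    assume "\<not> (\<exists>P\<in>?A. M \<subseteq> P)"
    then have "\<forall>P\<in>?A. \<exists>m. m \<in> M \<and> m \<notin> P" by blast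
    then obtain f where f: "\<forall>P\<in>?A. f P \<in> M \<and> f P \<notin> P" by metis
    let ?F = "insert a (f ` ?A)"
    have "frac_inverse D ?F \<subseteq> D"
    proof
      fix x assume x: "x \<in> frac_inverse D ?F"
      have "x \<in> localization D P" if P: "P \<in> ?H" for P
      proof -
        obtain y where y: "y \<in> ?F" "y \<notin> P" using f P by (cases "a \<in> P") auto
        have "x * y \<in> D" using x y(1) by (rule frac_inverse_memD)
        moreover have "y \<in> D" using y(1) a f M'(4) by blast
        moreover have "y \<noteq> 0" using y(2) prime_idealD(4) height_one_primesD(1)[OF P] by blast
        ultimately show ?thesis using localizationI[of "x * y" D y P] y(2) by simp
      qed
      then show "x \<in> D" using krull unfolding krull_domain_def by blast
    qed
    then have "1 \<in> v_closure D ?F" by (simp add: one_mem_v_closure_iff)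
    moreover have "v_closure D ?F \<subseteq> tspan D ?F" using fin by (intro v_closure_subset_tspan) simp
    moreover have "tspan D ?F \<subseteq> M"
      using f a t.star_idealD(2)[OF M'(1)] by (intro t.cl_subsetI) auto
    ultimately show False using M'(3) by blast
  qed
  then obtain P where "P \<in> ?H" "M \<subseteq> P" by blast
  then show ?thesis using height_one_primesD(3)[of P M] M_prime M'(1) t.star_idealD(4) by metis
qed

text \<open>
  With a uniformizer \<open>p\<close> of \<open>P\<close> the element \<open>c / p\<close> has value \<open>-1\<close> at \<open>P\<close> and is integral at
  all other height one primes.
\<close>

lemma krull_height_one_element:
  assumes krull: "krull_domain D" and P: "P \<in> height_one_primes D"
  obtains p c where "p \<in> P" "p \<noteq> 0" "c \<in> D" "c \<notin> P" "c / p \<in> frac_inverse D P"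
    "\<And>x. x \<in> localization D P \<Longrightarrow> x \<noteq> 0 \<Longrightarrow>
       \<exists>k u. x = p ^ k * u \<and> u \<in> localization D P \<and> inverse u \<in> localization D P"
proof -
  let ?H = "height_one_primes D"
  have dvr: "discrete_valuation_ring (localization D Q)" if "Q \<in> ?H" for Q
    using krull that by (simp add: krull_domain_def)
  note P' = height_one_primesD[OF P]
  note P'' = prime_idealD[OF P'(1)]
  obtain p where p: "p \<in> P" "p \<noteq> 0" "P \<subseteq> {p} * localization D P"
    and p_factor: "\<And>x. x \<in> localization D P \<Longrightarrow> x \<noteq> 0 \<Longrightarrow>
       \<exists>k u. x = p ^ k * u \<and> u \<in> localization D P \<and> inverse u \<in> localization D P"
    using discrete_valuation_ring_uniformizer[OF P'(1,2) dvr[OF P]] by metis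
  define A where "A = {Q \<in> ?H. p \<in> Q} - {P}"
  have "finite A" using krull p P''(1) by (auto simp: krull_domain_def A_def)
  \<comment> \<open>The witness is e^k with e \<in> Q outside P and k the value of p at Q: it is
    divisible by p at Q and remains outside P.\<close>
  have "\<exists>c. c \<in> D - P \<and> c / p \<in> localization D Q" if Q: "Q \<in> A" for Q
  proof -
    have QH: "Q \<in> ?H" "Q \<noteq> P" using Q by (auto simp: A_def)
    note Q' = height_one_primesD[OF QH(1)]
    note Q'' = prime_idealD[OF Q'(1)]
    interpret V: domain_in_field "localization D Q"
      using domain_in_field_localization Q' by blast
    have "\<not> Q \<subseteq> P" using P'(3)[OF Q'(1,2)] QH by blast
    then obtain e where e: "e \<in> Q" "e \<notin> P" by blast
    obtain q where q: "Q \<subseteq> {q} * localization D Q"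
      "\<And>x. x \<in> localization D Q \<Longrightarrow> x \<noteq> 0 \<Longrightarrow>
       \<exists>k u. x = q ^ k * u \<and> u \<in> localization D Q \<and> inverse u \<in> localization D Q"
      using discrete_valuation_ring_uniformizer[OF Q'(1,2) dvr[OF QH(1)]] by metis
    have "p \<in> localization D Q" using p P''(1) subset_localization[OF Q'(1)] by blast
    then obtain k u where u: "p = q ^ k * u" "inverse u \<in> localization D Q" using q(2) p by blast
    have "e \<in> {q} * localization D Q" using e q(1) by blast
    then obtain v where v: "v \<in> localization D Q" "e = q * v" unfolding mem_singleton_times by blast
    have "e ^ k / p = v ^ k * inverse u" using u p(2) v(2) by (auto simp: field_simps power_mult_distrib)
    moreover have "v ^ k * inverse u \<in> localization D Q" using u v by blast
    moreover have "e ^ k \<in> D - P" using e Q''(1) prime_power_notin[OF P'(1)] by blast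
    ultimately show ?thesis by auto
  qed
  then obtain f where f: "\<And>Q. Q \<in> A \<Longrightarrow> f Q \<in> D - P" "\<And>Q. Q \<in> A \<Longrightarrow> f Q / p \<in> localization D Q"
    by metis
  define c where "c = prod f A"
  have c: "c \<in> D - P" unfolding c_def using f(1) by (rule prime_prod_notin[OF P'(1)])
  have "c / p * y \<in> D" if y: "y \<in> P" for y
  proof -
    have yD: "y \<in> D" using y P'' by blast
    have "c / p * y \<in> localization D Q" if Q: "Q \<in> ?H" for Q
    proof -
      note Q' = height_one_primesD[OF Q]
      interpret V: domain_in_field "localization D Q"
        using domain_in_field_localization Q' by blast
      note DV = subset_localization[OF Q'(1)]
      \<comment> \<open>Integrality is checked prime by prime: at P the denominator p is absorbed by
        y, at the primes in \<open>A\<close> by the factor \<open>f Q\<close> of c, and at all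
        others p is a unit.\<close>
      consider "Q = P" | "Q \<in> A" | "p \<notin> Q" using Q by (auto simp: A_def)
      then show ?thesis
      proof cases
        case 1
        have "y \<in> {p} * localization D P" using y p by blast
        then obtain v where "v \<in> localization D P" "y = p * v" unfolding mem_singleton_times by blast
        then show ?thesis using c DV p(2) V.mult_mem[of c v] 1 by auto
      next
        case 2
        have "c / p * y = (f Q / p) * (prod f (A - {Q}) * y)"
          using \<open>finite A\<close> 2 by (simp add: c_def prod.remove)
        moreover have "prod f (A - {Q}) * y \<in> D"
          using prime_prod_notin[OF P'(1), of "A - {Q}" f] f(1) yD by blast
        ultimately show ?thesis using f(2)[OF 2] DV by (metis V.mult_mem subsetD)
      next
        case 3
        then show ?thesis using localizationI[of "c * y" D p Q] c yD p P''(1) by auto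
      qed
    qed
    then show ?thesis using krull unfolding krull_domain_def by blast
  qed
  then have "c / p \<in> frac_inverse D P" by (simp add: frac_inverse_def)
  then show ?thesis using that p c p_factor by blast
qed

text \<open>The product p (c / p) = c lies in M M^-1 but not in M, so the closure of M M^-1 exceeds
  M and is D. For the powers, (c / p)^n multiplies M^n, and therefore its t-closure, into D. As c is
  a unit of D_M, an element of all these closures is divisible in D_M by every p^n.\<close>

lemma krull_t_star_maximal:
  assumes krull: "krull_domain D" and M: "t.star_maximal M"
  shows "t.star_invertible M" "(\<Inter>n\<in>{1..}. tspan D (M ^ n)) = {0}"
proof -
  note M' = t.star_maximalD[OF M]
  note M_prime = t_star_maximal_primeideal[OF M]
  let ?V = "localization D M"
  have "M \<noteq> {0}" using M'(1) t.star_idealD(4) by blast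
  interpret V: domain_in_field ?V
    using domain_in_field_localization M_prime \<open>M \<noteq> {0}\<close> by blast
  obtain p c where p: "p \<in> M" "p \<noteq> 0" and c: "c \<in> D" "c \<notin> M" "c / p \<in> frac_inverse D M"
    and factor: "\<And>x. x \<in> ?V \<Longrightarrow> x \<noteq> 0 \<Longrightarrow> \<exists>k u. x = p ^ k * u \<and> u \<in> ?V \<and> inverse u \<in> ?V"
    using krull_height_one_element[OF krull t_star_maximal_height_one[OF krull M]] by metis
  show "t.star_invertible M"
  proof (rule ccontr)
    assume not_inv: "\<not> t.star_invertible M"
    let ?I = "tspan D (M * frac_inverse D M)"
    have I: "t.star_ideal ?I" using t.star_ideal_times_frac_inverse M' by blast
    have "?I \<noteq> D" using not_inv t.star_invertible_iff by blast
    then have "?I = M" using M'(5)[OF I] t.subset_cl_times_frac_inverse[OF M'(1) M'(1)] by blast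
    moreover have "p * (c / p) \<in> M * frac_inverse D M" using p c by (intro set_times_intro)
    then have "p * (c / p) \<in> ?I" by (rule subsetD[OF t.subset_cl])
    ultimately show False using p c by simp
  qed
  have "0 \<in> tspan D (M ^ n)" for n by (rule t.zero_cl)
  moreover have "y = 0" if y: "\<And>n. n \<ge> 1 \<Longrightarrow> y \<in> tspan D (M ^ n)" for y
  proof (rule ccontr)
    assume "y \<noteq> 0"
    have sub: "{(c / p) ^ n} * M ^ n \<subseteq> D" for n
    proof (induction n)
      case (Suc n)
      have "{(c / p) ^ Suc n} * M ^ Suc n = ({c / p} * M) * ({(c / p) ^ n} * M ^ n)"
        unfolding power_Suc singleton_times_singleton[symmetric] by (simp only: mult_ac)
      also have "{c / p} * M \<subseteq> D" using c(3) by (auto simp: set_times_def frac_inverse_def)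
      then have "({c / p} * M) * ({(c / p) ^ n} * M ^ n) \<subseteq> D * D" using Suc by (rule set_times_mono2)
      also have "D * D \<subseteq> D" using t.D_times_subset[OF t.cl_D] .
      finally show ?case .
    qed (use t.subset_cl in simp)
    have mem: "\<exists>v\<in>?V. y = p ^ n * v" if "n \<ge> 1" for n
    proof -
      have "(c / p) ^ n * y \<in> tspan D ({(c / p) ^ n} * M ^ n)" using y[OF that] by (rule t.mult_cl)
      also have "\<dots> \<subseteq> D" using sub t.cl_D by (rule t.cl_subsetI)
      finally have "(c / p) ^ n * y / c ^ n \<in> ?V"
        using c prime_power_notin[OF M_prime] by (intro localizationI) auto
      moreover have "c \<noteq> 0" using c prime_idealD(4)[OF M_prime] by blast
      then have "y = p ^ n * ((c / p) ^ n * y / c ^ n)" using p by (simp add: field_simps)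
      ultimately show ?thesis by blast
    qed
    then obtain v where "v \<in> ?V" "y = p ^ 1 * v" by blast
    then have "y \<in> ?V" using p M'(4) subset_localization[OF M_prime] by auto
    then obtain k u where u: "y = p ^ k * u" "inverse u \<in> ?V" using factor \<open>y \<noteq> 0\<close> by blast
    \<comment> \<open>The exponent exceeds the value k of y by one, so the unit u would be divisible
      by p.\<close>
    obtain w where w: "w \<in> ?V" "y = p ^ Suc k * w" using mem[of "Suc k"] by auto
    then have "u = p * w" "u \<noteq> 0" using u(1) p(2) \<open>y \<noteq> 0\<close> by auto
    then have "inverse p = w * inverse u" using p(2) by (auto simp: field_simps)
    then have "inverse p \<in> ?V" using w u by auto
    then show False using inverse_notin_localization[OF M_prime p] by blast
  qed
  ultimately show "(\<Inter>n\<in>{1..}. tspan D (M ^ n)) = {0}" by auto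
qed

lemma prod_list_mem: "(\<And>M. M \<in> set Ms \<Longrightarrow> M \<subseteq> D) \<Longrightarrow> prod_list Ms \<subseteq> D"
proof (induction Ms)
  case (Cons M Ms)
  then have "M * prod_list Ms \<subseteq> D * D" by (intro set_times_mono2) auto
  then show ?case using t.D_times_subset[OF t.cl_D] by auto
qed simp

lemma prime_contains_factor:
  assumes P: "primeideal P (ring_on D)" and Ms: "\<And>M. M \<in> set Ms \<Longrightarrow> M \<subseteq> D"
    and sub: "prod_list Ms \<subseteq> P"
  shows "\<exists>M\<in>set Ms. M \<subseteq> P"
  using Ms sub
proof (induction Ms)
  case Nil
  then show ?case using prime_idealD(3)[OF P] by simp
next
  case (Cons M Ms)
  show ?case
  proof (cases "M \<subseteq> P")
    case False
    then obtain m where m: "m \<in> M" "m \<notin> P" by blast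
    have "z \<in> P" if z: "z \<in> prod_list Ms" for z
    proof -
      have "m * z \<in> P" using m z Cons.prems(2) by auto
      moreover have "m \<in> D" using m Cons.prems(1) by auto
      moreover have "z \<in> D" using z prod_list_mem[of Ms] Cons.prems(1) by auto
      ultimately show ?thesis using m prime_idealD(5)[OF P] by blast
    qed
    then have "prod_list Ms \<subseteq> P" by blast
    then show ?thesis using Cons by auto
  qed simp
qed

section \<open>Domains in which every t-ideal is t-invertible\<close>

context
  assumes inv: "\<And>I. t.star_ideal I \<Longrightarrow> t.star_invertible I"
begin

text \<open>With I itself t-invertible, I M^-1 = I would cancel to M = D. So dividing by a maximal M
  \<supseteq> I gives a strictly larger ideal, and the induction splits off one maximal t-ideal at a
  time.\<close>

lemma t_star_ideal_factorization:
  assumes "t.star_ideal I"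
  shows "\<exists>Ms. (\<forall>M\<in>set Ms. t.star_maximal M) \<and> I = tspan D (prod_list Ms)"
proof -
  define Q where "Q I \<longleftrightarrow> (\<exists>Ms. (\<forall>M\<in>set Ms. t.star_maximal M) \<and> I = tspan D (prod_list Ms))" for I
  have fin: "\<exists>F. finite F \<and> F \<subseteq> I \<and> tspan D F = I" if "t.star_ideal I" for I
    using t.star_invertible_finite inv that t.star_idealD(2) by metis
  have step: "Q I" if I: "t.star_ideal I" and IH: "\<And>J. t.star_ideal J \<Longrightarrow> I \<subset> J \<Longrightarrow> Q J" for I
  proof (cases "I = D")
    case True
    then have "I = tspan D (prod_list [])" using t.cl_one by simp
    then show ?thesis unfolding Q_def by (intro exI[of _ "[]"]) simp
  next
    case False
    then obtain M where M: "t.star_maximal M" "I \<subseteq> M" using t.subset_star_maximal I by blast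
    note M' = t.star_maximalD[OF M(1)]
    let ?Q = "tspan D (I * frac_inverse D M)"
    have star: "t.star_ideal ?Q" using t.star_ideal_times_frac_inverse I M M' by blast
    have QM: "tspan D (?Q * M) = I"
      using t.cl_times_invertible_cancel[OF inv[OF M'(1)]] I t.star_idealD(2) by blast
    have "?Q \<noteq> I"
    proof
      assume "?Q = I"
      then have "tspan D (I * M) = I" using QM by simp
      then show False using t.star_invertible_absorb[OF I inv[OF I] M'(1)] M'(2) by blast
    qed
    then have "Q ?Q" using IH[OF star] t.subset_cl_times_frac_inverse[OF I M'(1)] by blast
    then obtain Ms where Ms: "\<forall>M\<in>set Ms. t.star_maximal M" "?Q = tspan D (prod_list Ms)"
      unfolding Q_def by blast
    have "I = tspan D (tspan D (prod_list Ms) * M)" using QM unfolding Ms(2) by (rule sym)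
    also have "\<dots> = tspan D (prod_list (M # Ms))" by (simp add: t.cl_times_cl_right mult.commute)
    finally show ?thesis unfolding Q_def using M(1) Ms(1) by (intro exI[of _ "M # Ms"]) auto
  qed
  have "Q I" using fin step assms by (rule t.star_induct[of Q])
  then show ?thesis by (simp add: Q_def)
qed

text \<open>Since aD is t-closed, the product of the factors lies in aD itself. The conclusion
  therefore covers every prime containing a, whether or not it is a t-ideal; it yields both the
  height one property and the finiteness condition.\<close>

lemma principal_factorization:
  assumes "a \<in> D" "a \<noteq> 0"
  obtains Ms where "\<And>M. M \<in> set Ms \<Longrightarrow> t.star_maximal M"
    "\<And>P. primeideal P (ring_on D) \<Longrightarrow> a \<in> P \<Longrightarrow> \<exists>M\<in>set Ms. M \<subseteq> P"
proof -
  have "t.star_ideal (tspan D {a})" using assms by (intro t.star_idealI[of _ a]) auto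
  then obtain Ms where Ms: "\<forall>M\<in>set Ms. t.star_maximal M" "tspan D {a} = tspan D (prod_list Ms)"
    using t_star_ideal_factorization by blast
  have "\<exists>M\<in>set Ms. M \<subseteq> P" if P: "primeideal P (ring_on D)" "a \<in> P" for P
  proof (rule prime_contains_factor[OF P(1)])
    show "M \<subseteq> D" if "M \<in> set Ms" for M using Ms(1) that t.star_maximalD(4) by blast
    have "prod_list Ms \<subseteq> {a} * D"
      using t.subset_cl[of "prod_list Ms"] Ms(2) t.cl_singleton[OF assms(2)] by simp
    also have "\<dots> \<subseteq> P" using P prime_idealD(6)[OF P(1)] by (auto simp: set_times_def mult.commute)
    finally show "prod_list Ms \<subseteq> P" .
  qed
  then show ?thesis using that Ms(1) by blast
qed

text \<open>Every nonzero prime contains a maximal t-ideal, by factoring one of its nonzero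
  elements, and two comparable maximal t-ideals are equal. So the maximal t-ideals are the minimal
  nonzero primes.\<close>

lemma height_one_primes_eq: "height_one_primes D = {M. t.star_maximal M}"
proof -
  have contains: "\<exists>M. t.star_maximal M \<and> M \<subseteq> P" if P: "primeideal P (ring_on D)" "P \<noteq> {0}" for P
  proof -
    obtain a where a: "a \<in> P" "a \<noteq> 0" using P prime_idealD(4) by blast
    moreover have "a \<in> D" using a P prime_idealD(1) by blast
    ultimately show ?thesis using principal_factorization[of a] P(1) by metis
  qed
  have prime: "primeideal M (ring_on D)" "M \<noteq> {0}" if "t.star_maximal M" for M
    using that t_star_maximal_primeideal t.star_maximalD(1) t.star_idealD(4) by blast+
  show ?thesis
  proof (intro equalityI subsetI)
    fix P assume P: "P \<in> height_one_primes D"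
    then show "P \<in> {M. t.star_maximal M}"
      using contains prime height_one_primesD[OF P] by (metis mem_Collect_eq)
  next
    fix M assume "M \<in> {M. t.star_maximal M}"
    then have M: "t.star_maximal M" by simp
    have "Q = M" if Q: "primeideal Q (ring_on D)" "Q \<noteq> {0}" "Q \<subseteq> M" for Q
    proof -
      obtain N where N: "t.star_maximal N" "N \<subseteq> Q" using contains Q by blast
      then have "M = N" using t.star_maximalD(5)[OF N(1)] t.star_maximalD(1,2)[OF M] Q by blast
      then show ?thesis using N Q by blast
    qed
    then show "M \<in> height_one_primes D" using prime[OF M] by (auto simp: height_one_primes_def)
  qed
qed

lemma Inter_localizations: "(\<Inter>M\<in>{M. t.star_maximal M}. localization D M) = D"
proof
  show "D \<subseteq> (\<Inter>M\<in>{M. t.star_maximal M}. localization D M)"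
    using subset_localization t_star_maximal_primeideal by blast
  show "(\<Inter>M\<in>{M. t.star_maximal M}. localization D M) \<subseteq> D"
  proof
    fix x assume x: "x \<in> (\<Inter>M\<in>{M. t.star_maximal M}. localization D M)"
    \<comment> \<open>This is the ideal of denominators of x, a t-ideal because every inverse is
      t-closed. A proper one would lie in some M, although x has a denominator outside M.\<close>
    let ?I = "frac_inverse D {1, x}"
    have I_iff: "d \<in> ?I \<longleftrightarrow> d \<in> D \<and> d * x \<in> D" for d by (auto simp: frac_inverse_def)
    obtain a b where ab: "a \<in> D" "b \<in> D" "b \<noteq> 0" "x = a / b" by (rule fractionE)
    then have "b \<in> ?I" unfolding I_iff by simp
    then have star: "t.star_ideal ?I"
      using ab(3) I_iff t.cl_frac_inverse by (auto simp: t.star_ideal_def)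
    have "?I = D"
    proof (rule ccontr)
      assume "?I \<noteq> D"
      then obtain M where M: "t.star_maximal M" "?I \<subseteq> M" using t.subset_star_maximal star by blast
      then have "x \<in> localization D M" using x by blast
      then obtain a s where as: "a \<in> D" "s \<in> D" "s \<notin> M" "x = a / s" by (rule localizationE)
      have "s \<noteq> 0" using as prime_idealD(4)[OF t_star_maximal_primeideal[OF M(1)]] by blast
      then have "s \<in> ?I" using as unfolding I_iff by simp
      then show False using M as by blast
    qed
    then have "1 \<in> ?I" by simp
    then show "x \<in> D" by (simp add: I_iff)
  qed
qed

text \<open>t-invertibility gives m \<in> M and x \<in> M^-1 with s = m x outside M, so that m
  generates the maximal ideal of D_M. It remains to exclude nonzero elements divisible by all powers
  of m, and this uses that M has height one.\<close>

lemma localization_discrete_valuation_ring: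
  assumes M: "t.star_maximal M"
  shows "discrete_valuation_ring (localization D M)"
proof -
  let ?V = "localization D M"
  note M' = t.star_maximalD[OF M]
  note M_prime = t_star_maximal_primeideal[OF M]
  note M_ideal = prime_idealD[OF M_prime]
  have "M \<in> height_one_primes D" using M height_one_primes_eq by blast
  note M_height = height_one_primesD(2,3)[OF this]
  interpret V: domain_in_field ?V
    using domain_in_field_localization[OF M_prime M_height(1)] .
  note DV = subset_localization[OF M_prime]
  have "\<not> M * frac_inverse D M \<subseteq> M"
  proof
    assume "M * frac_inverse D M \<subseteq> M"
    then have "tspan D (M * frac_inverse D M) \<subseteq> M"
      using t.cl_subsetI t.star_idealD(2)[OF M'(1)] by blast
    then show False using inv[OF M'(1)] M'(3) unfolding t.star_invertible_def by blast
  qed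
  then obtain m x where m: "m \<in> M" "x \<in> frac_inverse D M" "m * x \<notin> M"
    unfolding set_times_subset_iff by blast
  define s where "s = m * x"
  have s: "s \<in> D" "s \<notin> M" "s \<noteq> 0" "m \<noteq> 0"
    using m frac_inverse_memD'[OF m(2,1)] M_ideal(4) by (auto simp: s_def)
  have "m \<in> D" using m M' by blast
  note inv_m = inverse_notin_localization[OF M_prime m(1) s(4)]
  \<comment> \<open>For b \<in> M the identity b = m (b x) / s shows that m divides b in
    D_M.\<close>
  have dichotomy: "inverse y \<in> ?V \<or> y \<in> {m} * ?V" if y: "y \<in> ?V" for y
  proof -
    obtain b t where bt: "b \<in> D" "t \<in> D" "t \<notin> M" "y = b / t" using y by (rule localizationE)
    show ?thesis
    proof (cases "b \<in> M")
      case True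
      have "b * x \<in> D" using frac_inverse_memD'[OF m(2) True] .
      then have "(b * x) / (t * s) \<in> ?V" using bt s M_ideal(5) by (intro localizationI) auto
      moreover have "m * ((b * x) / (t * s)) = (b * s) / (t * s)" by (simp add: s_def mult_ac)
      then have "y = m * ((b * x) / (t * s))" using bt(4) s(3) by simp
      ultimately show ?thesis unfolding mem_singleton_times by blast
    qed (use bt localizationI[of t D b M] in simp)
  qed
  have unit_notin: "u \<notin> {m} * ?V" if u: "u \<noteq> 0" "inverse u \<in> ?V" for u
  proof
    assume "u \<in> {m} * ?V"
    then obtain v where v: "v \<in> ?V" "u = m * v" unfolding mem_singleton_times by blast
    then have "inverse m = v * inverse u" using u(1) by (auto simp: field_simps)
    then have "inverse m \<in> ?V" using V.mult_mem[OF v(1) u(2)] by metis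
    then show False using inv_m by blast
  qed
  define good where "good y \<longleftrightarrow> (\<exists>k u. y = m ^ k * u \<and> u \<in> ?V \<and> inverse u \<in> ?V)" for y
  have not_good: "y \<in> {m ^ k} * ?V" if "y \<in> ?V" "\<not> good y" for y k
  proof (induction k)
    case 0
    then show ?case using that by simp
  next
    case (Suc k)
    then obtain v where v: "v \<in> ?V" "y = m ^ k * v" unfolding mem_singleton_times by blast
    then have "v \<in> {m} * ?V" using dichotomy[OF v(1)] that(2) unfolding good_def by blast
    then obtain w where "w \<in> ?V" "v = m * w" unfolding mem_singleton_times by blast
    then show ?case using v by (intro set_times_memI[of "m ^ Suc k" _ w]) auto
  qed
  have good: "y \<notin> {m ^ Suc k} * ?V" if y: "y \<noteq> 0" "y = m ^ k * u" "inverse u \<in> ?V" for y k u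
  proof
    assume "y \<in> {m ^ Suc k} * ?V"
    then obtain w where w: "w \<in> ?V" "y = m ^ Suc k * w" unfolding mem_singleton_times by blast
    then have "u = m * w" "u \<noteq> 0" using y s(4) by auto
    then show False using unit_notin[of u] y w by (auto intro: set_times_memI)
  qed
  \<comment> \<open>Besides 0, these are exactly the elements of D that are not \<open>good\<close>.
    Since products of good elements are good, N is a prime ideal; it is contained in M and misses m,
    so it is zero.\<close>
  define N where "N = {d \<in> D. \<forall>k. d \<in> {m ^ k} * ?V}"
  have N_good: "d \<in> N \<longleftrightarrow> d = 0 \<or> \<not> good d" if "d \<in> D" for d
  proof (cases "d = 0")
    case True
    then show ?thesis by (auto simp: N_def intro: set_times_memI[of "m ^ _" _ 0])
  next
    case False
    then show ?thesis using that not_good[of d] good[OF False] DV unfolding N_def good_def by blast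
  qed
  have N_mult: "d * x \<in> N" if "d \<in> D" "x \<in> N" for d x
  proof -
    have "d * x \<in> {m ^ k} * ?V" for k
    proof -
      have "x \<in> {m ^ k} * ?V" using that by (simp add: N_def)
      then obtain v where "v \<in> ?V" "x = m ^ k * v" unfolding mem_singleton_times by blast
      then show ?thesis using that(1) DV by (intro set_times_memI[of "m ^ k" _ "d * v"]) (auto simp: mult_ac)
    qed
    then show ?thesis using that by (auto simp: N_def)
  qed
  have N_add: "x + y \<in> N" if "x \<in> N" "y \<in> N" for x y
  proof -
    have "x + y \<in> {m ^ k} * ?V" for k
    proof -
      have "x \<in> {m ^ k} * ?V" "y \<in> {m ^ k} * ?V" using that by (simp_all add: N_def)
      then obtain v w where "v \<in> ?V" "x = m ^ k * v" "w \<in> ?V" "y = m ^ k * w"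
        unfolding mem_singleton_times by blast
      then show ?thesis by (intro set_times_memI[of "m ^ k" _ "v + w"]) (auto simp: distrib_left)
    qed
    then show ?thesis using that by (auto simp: N_def)
  qed
  have "0 \<in> N" using N_good by blast
  have good_mult: "good (a * b)" if ab: "good a" "good b" for a b
  proof -
    obtain k u l v where uv: "a = m ^ k * u" "u \<in> ?V" "inverse u \<in> ?V" "b = m ^ l * v" "v \<in> ?V" "inverse v \<in> ?V"
      using ab unfolding good_def by blast
    then have "a * b = m ^ (k + l) * (u * v)" by (simp add: power_add mult_ac)
    moreover have "inverse (u * v) \<in> ?V" using uv by auto
    ultimately show ?thesis using uv unfolding good_def by blast
  qed
  have prime: "primeideal N (ring_on D)"
    unfolding primeideal_iff
  proof (intro conjI ballI impI)
    show "N \<subseteq> D" by (auto simp: N_def)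
    show "dspan D N = N"
      using dspan_least[of N N] N_mult N_add \<open>0 \<in> N\<close> subset_dspan[of N] by blast
    have "good 1" unfolding good_def by (intro exI[of _ 0] exI[of _ 1]) auto
    then show "1 \<notin> N" using N_good[of 1] by simp
    fix a b assume "a \<in> D" "b \<in> D" "a * b \<in> N"
    then show "a \<in> N \<or> b \<in> N" using N_good good_mult[of a b] mult_mem mult_eq_0_iff by metis
  qed
  have "N \<subseteq> M"
  proof
    fix d assume d: "d \<in> N"
    have "d \<in> {m ^ 1} * ?V" using d unfolding N_def by blast
    then have "d \<in> {m} * ?V" by simp
    then have "d = 0 \<or> inverse d \<notin> ?V" using unit_notin by blast
    then show "d \<in> M" using d M_ideal(4) localization_inverse[of d M] by (auto simp: N_def)
  qed
  moreover have "good m" unfolding good_def by (intro exI[of _ 1] exI[of _ 1]) auto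
  then have "m \<notin> N" using N_good[OF \<open>m \<in> D\<close>] s(4) by simp
  ultimately have "N = {0}" using M_height(2)[OF prime] m(1) by blast
  have "good y" if y: "y \<in> ?V" "y \<noteq> 0" for y
  proof (rule ccontr)
    assume bad: "\<not> good y"
    obtain b t where bt: "b \<in> D" "t \<in> D" "t \<notin> M" "y = b / t" using y(1) by (rule localizationE)
    have "t \<noteq> 0" "b \<noteq> 0" using bt y M_ideal(4) by auto
    have "b \<in> {m ^ k} * ?V" for k
    proof -
      obtain v where "v \<in> ?V" "y = m ^ k * v" using not_good[OF y(1) bad] unfolding mem_singleton_times by blast
      then show ?thesis using bt \<open>t \<noteq> 0\<close> DV
        by (intro set_times_memI[of "m ^ k" _ "t * v"]) (auto simp: field_simps)
    qed
    then have "b \<in> N" using bt by (simp add: N_def)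
    then show False using \<open>N = {0}\<close> \<open>b \<noteq> 0\<close> by blast
  qed
  then show ?thesis
    using V.discrete_valuation_ringI[of m] \<open>m \<in> D\<close> DV s(4) inv_m unfolding good_def by blast
qed

lemma t_invertible_imp_krull: "krull_domain D"
  unfolding krull_domain_def height_one_primes_eq
proof (intro conjI ballI domain_ring_on Inter_localizations)
  show "discrete_valuation_ring (localization D P)" if "P \<in> {M. t.star_maximal M}" for P
    using that localization_discrete_valuation_ring by blast
  fix a assume "a \<in> D - {0}"
  then obtain Ms where Ms: "\<And>M. M \<in> set Ms \<Longrightarrow> t.star_maximal M"
    "\<And>P. primeideal P (ring_on D) \<Longrightarrow> a \<in> P \<Longrightarrow> \<exists>M\<in>set Ms. M \<subseteq> P"
    using principal_factorization[of a] by blast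
  have "P \<in> set Ms" if P: "t.star_maximal P" "a \<in> P" for P
  proof -
    obtain M where M: "M \<in> set Ms" "M \<subseteq> P" using Ms(2) t_star_maximal_primeideal P by blast
    then have "P = M" using t.star_maximalD(5)[OF Ms(1)] t.star_maximalD(1,2)[OF P(1)] by blast
    then show ?thesis using M by simp
  qed
  then have "{P \<in> {M. t.star_maximal M}. a \<in> P} \<subseteq> set Ms" by blast
  then show "finite {P \<in> {M. t.star_maximal M}. a \<in> P}" by (rule finite_subset) simp
qed

end

theorem krull_domain_iff: "krull_domain D \<longleftrightarrow> (\<forall>I. t.star_ideal I \<longrightarrow> t.star_invertible I)"
proof
  assume krull: "krull_domain D"
  show "\<forall>I. t.star_ideal I \<longrightarrow> t.star_invertible I"
  proof (intro allI impI)
    fix I assume I: "t.star_ideal I"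
    have times: "t.star_invertible (tspan D (I * J))" if "t.star_invertible I" "t.star_invertible J" for I J
      using that t.star_invertible_cl t.star_invertible_times by blast
    show "t.star_invertible I"
      using t.star_ideals_good[of t.star_invertible, OF t.star_invertible_D times _ _ _ I]
        krull_t_star_maximal[OF krull] by blast
  qed
qed (use t_invertible_imp_krull in blast)

end

section \<open>Locally factorial Krull domains\<close>

context domain_in_field
begin

lemma d_star_maximal_primeideal: "d.star_maximal M \<Longrightarrow> primeideal M (ring_on D)"
  using d.star_maximalD(1,3,4)[of M] d.star_maximal_prime[of M] d.star_idealD(2)
  unfolding primeideal_iff by blast

text \<open>Otherwise M M^-1 lies in a maximal ideal N. In the UFD D_N the extension of M contains a
  prime element q = f/s with f \<in> M and s a unit. The contraction of q D_N is a nonzero prime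
  inside M, so it is M because M has height one; hence M \<subseteq> f D_N. Clearing denominators
  gives r outside N with r/f \<in> M^-1, so r = f (r/f) lies in M M^-1 \<subseteq> N.\<close>

lemma locally_factorial_t_maximal_invertible:
  assumes krull: "krull_domain D" and lf: "locally_factorial D" and M: "t.star_maximal M"
  shows "d.star_invertible M"
proof (rule ccontr)
  assume not_inv: "\<not> d.star_invertible M"
  note M' = t.star_maximalD[OF M]
  have M_prime: "primeideal M (ring_on D)" and M0: "M \<noteq> {0}"
    using M t_star_maximal_primeideal M'(1) t.star_idealD(4) by blast+
  have Md: "d.star_ideal M" using M'(1) by (rule t_star_ideal_imp_d)
  let ?J = "dspan D (M * frac_inverse D M)"
  have "?J \<noteq> D" using not_inv d.star_invertible_iff by blast
  moreover have "d.star_ideal ?J" using d.star_ideal_times_frac_inverse Md by blast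
  ultimately obtain N where N: "d.star_maximal N" "?J \<subseteq> N" using d.subset_star_maximal by blast
  have "M \<subseteq> N" using N(2) d.subset_cl_times_frac_inverse[OF Md Md] by blast
  note N_prime = d_star_maximal_primeideal[OF N(1)]
  note N_ideal = prime_idealD[OF N_prime]
  let ?V = "localization D N"
  have N0: "N \<noteq> {0}" using d.star_maximalD(1)[OF N(1)] d.star_idealD(4) by blast
  interpret V: domain_in_field ?V using domain_in_field_localization[OF N_prime N0] .
  have UFD: "factorial_domain (ring_on ?V)"
    using lf N(1) by (simp add: locally_factorial_def maximalideal_iff)
  note DV = subset_localization[OF N_prime]
  define Q where "Q = {p / s | p s. p \<in> M \<and> s \<in> D - N}"
  have Q: "primeideal Q (ring_on ?V)" "M \<subseteq> Q" "Q \<inter> D = M"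
    using localization_prime_ideal[OF M_prime M0 N_prime \<open>M \<subseteq> N\<close>] by (simp_all add: Q_def)
  have "Q \<noteq> {0}" using Q(2) M0 prime_idealD(4)[OF M_prime] by blast
  then obtain q where q: "q \<in> Q" "q \<noteq> 0" "primeideal ({q} * ?V) (ring_on ?V)"
    using V.factorial_prime_ideal[OF UFD Q(1)] by metis
  obtain f s where f: "f \<in> M" "s \<in> D" "s \<notin> N" "q = f / s" using q(1) by (auto simp: Q_def)
  then have s: "s \<noteq> 0" "f \<noteq> 0" using q N_ideal(4) by auto
  have qf: "{q} * ?V \<subseteq> {f} * ?V"
  proof
    fix x assume "x \<in> {q} * ?V"
    then obtain v where "v \<in> ?V" "x = q * v" unfolding mem_singleton_times by blast
    then have "x = f * (inverse s * v)" "inverse s * v \<in> ?V"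
      using f localization_inverse[of s N] by (auto simp: divide_inverse)
    then show "x \<in> {f} * ?V" unfolding mem_singleton_times by blast
  qed
  note q_ideal = V.prime_idealD[OF q(3)]
  define P where "P = {q} * ?V \<inter> D"
  have "f \<in> P"
  proof -
    have "f = q * s" "s \<in> ?V" using f s DV by auto
    then have "f \<in> {q} * ?V" unfolding mem_singleton_times by blast
    then show ?thesis using f M'(4) by (auto simp: P_def)
  qed
  have P_prime: "primeideal P (ring_on D)"
    unfolding primeideal_iff
  proof (intro conjI ballI impI)
    have "dspan D P \<subseteq> P"
    proof (rule dspan_least)
      show "x + y \<in> P" if "x \<in> P" "y \<in> P" for x y
        using that q_ideal(2) dspan.add[of x ?V "{q} * ?V" y] by (auto simp: P_def)
      show "d * x \<in> P" if "d \<in> D" "x \<in> P" for d x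
        using that q_ideal(6)[of d x] DV by (auto simp: P_def)
    qed (use q_ideal(4) in \<open>auto simp: P_def\<close>)
    then show "dspan D P = P" using subset_dspan by blast
    fix a b assume "a \<in> D" "b \<in> D" "a * b \<in> P"
    then show "a \<in> P \<or> b \<in> P" using q_ideal(5)[of a b] DV by (auto simp: P_def)
  qed (use q_ideal(3) in \<open>auto simp: P_def\<close>)
  have "{q} * ?V \<subseteq> Q"
    using V.prime_idealD(6)[OF Q(1) _ q(1)] by (auto simp: set_times_def mult.commute)
  then have "P \<subseteq> M" using Q(3) by (auto simp: P_def)
  then have "P = M"
    using height_one_primesD(3)[OF t_star_maximal_height_one[OF krull M] P_prime] \<open>f \<in> P\<close> s by blast
  then have M_sub: "M \<subseteq> {f} * ?V" using qf by (auto simp: P_def)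
  \<comment> \<open>M need not be finitely generated as an ideal, but a finite F with t-closure M
    has the same inverse, so only finitely many denominators have to be cleared.\<close>
  obtain F where F: "finite F" "F \<subseteq> M" "tspan D F = M"
    using t.star_invertible_finite[OF t.star_idealD(2)[OF M'(1)]] krull_t_star_maximal(1)[OF krull M] by metis
  have "(\<lambda>p. p / f) ` F \<subseteq> ?V"
  proof (intro image_subsetI)
    fix p assume "p \<in> F"
    then have "p \<in> {f} * ?V" using F M_sub by blast
    then show "p / f \<in> ?V" using s by (auto simp: set_times_def)
  qed
  then obtain r where r: "r \<in> D - N" "\<forall>z\<in>(\<lambda>p. p / f) ` F. r * z \<in> D"
    using localization_common_denominator[OF N_prime finite_imageI[OF F(1)]] by blast
  then have "r / f \<in> frac_inverse D F" by (auto simp: frac_inverse_def)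
  also have "frac_inverse D F = frac_inverse D M" using t.frac_inverse_cl[of F] F(3) by simp
  finally have "f * (r / f) \<in> M * frac_inverse D M" using f(1) by (intro set_times_intro)
  then have "f * (r / f) \<in> N" using N(2) subset_dspan by blast
  then show False using r s by simp
qed

text \<open>A t-ideal I of D_N contracts to a t-ideal A of D. Since A is invertible, some a \<in> A
  and x \<in> A^-1 have a x outside N, and for b \<in> A the element b x / (a x) of D_N shows that a
  divides b there. So a generates I, and \<open>factorial_domainI\<close> applies to D_N.\<close>

lemma localization_factorial:
  assumes inv: "\<And>I. t.star_ideal I \<Longrightarrow> d.star_invertible I" and N: "d.star_maximal N"
  shows "factorial_domain (ring_on (localization D N))"
proof -
  let ?V = "localization D N"
  note N_prime = d_star_maximal_primeideal[OF N]
  note N_ideal = prime_idealD[OF N_prime]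
  have N0: "N \<noteq> {0}" using d.star_maximalD(1)[OF N] d.star_idealD(4) by blast
  interpret V: domain_in_field ?V using domain_in_field_localization[OF N_prime N0] .
  note DV = subset_localization[OF N_prime]
  show ?thesis
  proof (rule V.factorial_domainI)
    fix I assume I: "V.t.star_ideal I"
    define A where "A = I \<inter> D"
    have num: "b \<in> A" if "b / s \<in> I" "b \<in> D" "s \<in> D - N" for b s
    proof -
      have "s \<noteq> 0" using that N_ideal(4) by auto
      have "s * (b / s) \<in> I" using V.t.star_ideal_scale[OF I] that DV by blast
      then show ?thesis using that \<open>s \<noteq> 0\<close> by (simp add: A_def)
    qed
    have "tspan D A \<subseteq> A"
    proof
      fix z assume z: "z \<in> tspan D A"
      have zD: "z \<in> D" using z t.cl_subsetI[OF _ t.cl_D, of A] by (auto simp: A_def)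
      obtain F where F: "finite F" "F \<subseteq> A" "z \<in> v_closure D F" using z by (auto simp: mem_tspan_iff)
      \<comment> \<open>As F is finite, some r outside N moves y into the inverse of F over D, where
        z is known to act, and r is a unit of D_N.\<close>
      have "z * y \<in> ?V" if y: "y \<in> frac_inverse ?V F" for y
      proof -
        have "(*) y ` F \<subseteq> ?V" using y by (auto simp: frac_inverse_def)
        then obtain r where r: "r \<in> D - N" "\<forall>w\<in>(*) y ` F. r * w \<in> D"
          using localization_common_denominator[OF N_prime finite_imageI[OF F(1)]] by blast
        then have "r * y \<in> frac_inverse D F" by (auto simp: frac_inverse_def mult.assoc)
        then have "z * (r * y) \<in> D" using F(3) frac_inverse_memD unfolding v_closure_def by blast
        then have "z * (r * y) / r \<in> ?V" using r(1) by (intro localizationI) auto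
        moreover have "r \<noteq> 0" using r(1) N_ideal(4) by auto
        ultimately show ?thesis by simp
      qed
      then have "z \<in> v_closure ?V F" by (simp add: v_closure_def frac_inverse_def[of _ "frac_inverse _ _"])
      then have "z \<in> tspan ?V F" using V.v_closure_subset_tspan[OF F(1)] by blast
      moreover have "tspan ?V F \<subseteq> I"
        using F(2) V.t.star_idealD(2)[OF I] by (intro V.t.cl_subsetI) (auto simp: A_def)
      ultimately show "z \<in> A" using zD by (auto simp: A_def)
    qed
    moreover obtain y where y: "y \<in> I" "y \<noteq> 0" using V.t.star_idealD(5)[OF I] by blast
    moreover have "y \<in> ?V" using y V.t.star_idealD(1)[OF I] by blast
    then obtain b s where bs: "b \<in> D" "s \<in> D" "s \<notin> N" "y = b / s" by (rule localizationE)
    have "b \<in> A" "b \<noteq> 0" using num bs y by auto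
    ultimately have "t.star_ideal A" using t.subset_cl[of A] by (auto simp: t.star_ideal_def A_def)
    then have A_inv: "d.star_invertible A" by (rule inv)
    have "\<not> A * frac_inverse D A \<subseteq> N"
    proof
      assume "A * frac_inverse D A \<subseteq> N"
      then have "dspan D (A * frac_inverse D A) \<subseteq> N" using N_ideal(2) by (rule d.cl_subsetI)
      then show False using A_inv N_ideal(3) by (auto simp: d.star_invertible_def)
    qed
    then obtain a x where ax: "a \<in> A" "x \<in> frac_inverse D A" "a * x \<notin> N"
      unfolding set_times_subset_iff by blast
    have axD: "a * x \<in> D" using frac_inverse_memD'[OF ax(2,1)] .
    have "a * x \<noteq> 0" using ax(3) N_ideal(4) by auto
    have "I \<subseteq> {a} * ?V"
    proof
      fix y assume y: "y \<in> I"
      then have "y \<in> ?V" using V.t.star_idealD(1)[OF I] by blast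
      then obtain b s where bs: "b \<in> D" "s \<in> D" "s \<notin> N" "y = b / s" by (rule localizationE)
      have "b \<in> A" using num bs y by auto
      then have "b * x \<in> D" using frac_inverse_memD'[OF ax(2)] by blast
      moreover have "s * (a * x) \<notin> N" using bs ax axD N_ideal(5) by blast
      ultimately have "(b * x) / (s * (a * x)) \<in> ?V" using bs axD by (intro localizationI) auto
      moreover have "a * ((b * x) / (s * (a * x))) = b * (a * x) / (s * (a * x))" by (simp add: mult_ac)
      then have "y = a * ((b * x) / (s * (a * x)))" using \<open>a * x \<noteq> 0\<close> bs(4) by simp
      ultimately show "y \<in> {a} * ?V" unfolding mem_singleton_times by blast
    qed
    moreover have "{a} * ?V \<subseteq> I"
      using V.t.star_ideal_scale[OF I] ax(1) by (auto simp: A_def set_times_def mult.commute)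
    ultimately have "I = {a} * ?V" by blast
    moreover have "a \<in> ?V" using ax(1) DV by (auto simp: A_def)
    ultimately show "\<exists>a\<in>?V. I = {a} * ?V" by blast
  qed
qed

lemma d_invertible_dspan_times:
  assumes "d.star_invertible I" "d.star_invertible J"
  shows "d.star_invertible (tspan D (I * J))"
  using d.star_invertible_times[OF assms] d_invertible_tspan d.star_invertible_cl by simp

theorem locally_factorial_krull_iff:
  "locally_factorial D \<and> krull_domain D \<longleftrightarrow> (\<forall>I. t.star_ideal I \<longrightarrow> d.star_invertible I)"
proof
  assume lfk: "locally_factorial D \<and> krull_domain D"
  show "\<forall>I. t.star_ideal I \<longrightarrow> d.star_invertible I"
  proof (intro allI impI)
    fix I assume I: "t.star_ideal I"
    show "d.star_invertible I"
      using t.star_ideals_good[of d.star_invertible, OF d.star_invertible_D d_invertible_dspan_times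
          d_invertible_imp_t _ _ I]
        locally_factorial_t_maximal_invertible krull_t_star_maximal(2) lfk by blast
  qed
next
  assume "\<forall>I. t.star_ideal I \<longrightarrow> d.star_invertible I"
  then have inv: "d.star_invertible I" if "t.star_ideal I" for I using that by blast
  have "krull_domain D" unfolding krull_domain_iff using inv d_invertible_imp_t by blast
  moreover have "locally_factorial D"
    unfolding locally_factorial_def maximalideal_iff using localization_factorial[OF inv] by blast
  ultimately show "locally_factorial D \<and> krull_domain D" by blast
qed

section \<open>Maximal ideals and their powers\<close>

lemma t_star_ideals_invertible_iff:
  "(\<forall>I. t.star_ideal I \<longrightarrow> d.star_invertible I) \<longleftrightarrow>
   (\<forall>M. t.star_maximal M \<longrightarrow> d.star_invertible M \<and> (\<Inter>n\<in>{1..}. tspan D (M ^ n)) = {0})"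
  by (rule t.all_star_ideals_good_iff) (rule d.star_invertible_D d_invertible_dspan_times d_invertible_imp_t; assumption)+

lemma d_star_ideals_invertible_iff:
  "(\<forall>I. d.star_ideal I \<longrightarrow> d.star_invertible I) \<longleftrightarrow>
   (\<forall>M. d.star_maximal M \<longrightarrow> d.star_invertible M \<and> (\<Inter>n\<in>{1..}. dspan D (M ^ n)) = {0})"
  using d.all_star_ideals_good_iff[of d.star_invertible] d.star_invertible_D d.star_invertible_times
    d.star_invertible_cl by blast

lemma t_star_ideals_t_invertible_iff:
  "(\<forall>I. t.star_ideal I \<longrightarrow> t.star_invertible I) \<longleftrightarrow>
   (\<forall>M. t.star_maximal M \<longrightarrow> t.star_invertible M \<and> (\<Inter>n\<in>{1..}. tspan D (M ^ n)) = {0})"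
  using t.all_star_ideals_good_iff[of t.star_invertible] t.star_invertible_D t.star_invertible_times
    t.star_invertible_cl by blast

lemma ideal_power_eq_tspan:
  assumes "ideal M (ring_on D)" "d.star_invertible M"
  shows "ideal_power D M n = tspan D (M ^ n)"
  using assms by (simp add: ideal_power_eq_dspan d_invertible_tspan d.star_invertible_power)

text \<open>For a t-invertible ideal the v- and t-closures agree, so the v-closed powers of M are
  the t-closed powers of the general criterion.\<close>

lemma v_closure_ideal_power_eq_tspan:
  assumes "ideal M (ring_on D)" "t.star_invertible M"
  shows "v_closure D (ideal_power D M n) = tspan D (M ^ n)"
  using assms by (simp add: ideal_power_eq_dspan v_closure_dspan t.v_closure_star_invertible t.star_invertible_power)

lemma d_star_maximal_ideal: "d.star_maximal M \<Longrightarrow> d.star_ideal M \<and> ideal M (ring_on D)"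
  using d.star_maximalD(1) d_star_ideal_iff by blast

lemma t_star_maximal_ideal: "t.star_maximal M \<Longrightarrow> d.star_ideal M \<and> ideal M (ring_on D)"
  using t.star_maximalD(1) t_star_ideal_imp_d d_star_ideal_iff by blast

theorem principal_domain_char:
  "principal_domain (ring_on D) \<longleftrightarrow>
     (\<forall>M. maximalideal M (ring_on D) \<longrightarrow>
        principalideal M (ring_on D) \<and> (\<Inter>n\<in>{1..}. ideal_power D M n) = {0})"
  unfolding principal_domain_iff d_star_ideals_principal_iff maximalideal_iff principalideal_iff
  using d_star_maximal_ideal by (simp add: ideal_power_eq_dspan cong: imp_cong)

theorem dedekind_domain_char:
  "dedekind_domain D \<longleftrightarrow>
     (\<forall>M. maximalideal M (ring_on D) \<longrightarrow>
        invertible_ideal D M \<and> (\<Inter>n\<in>{1..}. ideal_power D M n) = {0})"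
  unfolding dedekind_domain_iff d_star_ideals_invertible_iff maximalideal_iff
  using d_star_maximal_ideal by (simp add: ideal_power_eq_dspan invertible_ideal_iff cong: imp_cong)

theorem factorial_domain_char:
  "factorial_domain (ring_on D) \<longleftrightarrow>
     (\<forall>M. maximal_t_ideal D M \<longrightarrow>
        principalideal M (ring_on D) \<and> (\<Inter>n\<in>{1..}. ideal_power D M n) = {0})"
proof -
  \<comment> \<open>Powers of an invertible M are already t-closed. \<open>conj_cong\<close> lets
    the principality of M be used when the intersection in the second conjunct is rewritten.\<close>
  have "d.star_invertible M" if "t.star_maximal M" "\<exists>a\<in>D. M = {a} * D" for M
    using that t.principal_ideal_nonzero t.star_maximalD(1) singleton_times_invertible by blast
  then show ?thesis
    unfolding factorial_domain_iff t_star_ideals_principal_iff maximal_t_ideal_iff principalideal_iff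
    using t_star_maximal_ideal by (simp add: ideal_power_eq_tspan cong: imp_cong conj_cong)
qed

theorem locally_factorial_krull_char:
  "locally_factorial D \<and> krull_domain D \<longleftrightarrow>
     (\<forall>M. maximal_t_ideal D M \<longrightarrow>
        invertible_ideal D M \<and> (\<Inter>n\<in>{1..}. ideal_power D M n) = {0})"
  unfolding locally_factorial_krull_iff t_star_ideals_invertible_iff maximal_t_ideal_iff
  using t_star_maximal_ideal
  by (simp add: ideal_power_eq_tspan invertible_ideal_iff cong: imp_cong conj_cong)

theorem krull_domain_char:
  "krull_domain D \<longleftrightarrow>
     (\<forall>M. maximal_t_ideal D M \<longrightarrow>
        t_invertible_ideal D M \<and> (\<Inter>n\<in>{1..}. v_closure D (ideal_power D M n)) = {0})"
  unfolding krull_domain_iff t_star_ideals_t_invertible_iff maximal_t_ideal_iff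
  using t_star_maximal_ideal
  by (simp add: v_closure_ideal_power_eq_tspan t_invertible_ideal_iff cong: imp_cong conj_cong)

end

theorem theorem3p6:
  fixes D :: "'k::field set"
  assumes "domain (ring_on D)"
    and "has_quotient_field D"
    and "\<not> field (ring_on D)"
  shows
    "(principal_domain (ring_on D) \<longleftrightarrow>
       (\<forall>M. maximalideal M (ring_on D) \<longrightarrow>
          principalideal M (ring_on D) \<and> (\<Inter>n\<in>{1..}. ideal_power D M n) = {0}))
   \<and> (dedekind_domain D \<longleftrightarrow>
       (\<forall>M. maximalideal M (ring_on D) \<longrightarrow>
          invertible_ideal D M \<and> (\<Inter>n\<in>{1..}. ideal_power D M n) = {0}))
   \<and> (factorial_domain (ring_on D) \<longleftrightarrow>
       (\<forall>M. maximal_t_ideal D M \<longrightarrow>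
          principalideal M (ring_on D) \<and> (\<Inter>n\<in>{1..}. ideal_power D M n) = {0}))
   \<and> (locally_factorial D \<and> krull_domain D \<longleftrightarrow>
       (\<forall>M. maximal_t_ideal D M \<longrightarrow>
          invertible_ideal D M \<and> (\<Inter>n\<in>{1..}. ideal_power D M n) = {0}))
   \<and> (krull_domain D \<longleftrightarrow>
       (\<forall>M. maximal_t_ideal D M \<longrightarrow>
          t_invertible_ideal D M \<and> (\<Inter>n\<in>{1..}. v_closure D (ideal_power D M n)) = {0}))"
proof -
  interpret domain_in_field D using assms by (rule domain_in_fieldI)
  show ?thesis
    by (intro conjI principal_domain_char dedekind_domain_char factorial_domain_char
        locally_factorial_krull_char krull_domain_char)
qed

end
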